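(* Let $\Gamma$ be a subgroup of $\mathrm{SL}_2(\mathbb{Z})$ of finite index, $k$ an integer and $\phi\in J_k(\Gamma)$. Then for every $X\in\mathbb{Q}^2$ the function $\phi_X(\tau):=(\phi|''_kX)(\tau,0)$ is a nearly holomorphic modular form of weight $k$ (i.e. holomorphic on $\mathfrak{H}$, satisfying $(c\tau+d)^{-k}\phi_X(\frac{a\tau+b}{c\tau+d})=\phi_X(\tau)$ for all $\begin{pmatrix}a&b\\c&d\end{pmatrix}$ in the subgroup, and meromorphic at every cusp) on some subgroup of $\Gamma$ of finite index depending only on $\Gamma$ and $X$.
   Context: $\mathfrak{H}$ is the upper half-plane, $e(x)=\exp(2\pi ix)$, $q=e(\tau)$, $\zeta=e(z)$. For a lattice $L=[\omega_1,\omega_2]$, $\eta(\omega,L)$ for $\omega\in L$ is the quasi-period of the Weierstrass $\zeta$-function ($\zeta(z+\omega,L)=\zeta(z,L)+\eta(\omega,L)$), extended $\mathbb{R}$-linearly. $\psi(z,L)=-1$ if $z\in L-2L$, $1$ otherwise; $\psi(\lambda\ \mu):=\psi(\lambda\tau+\mu,[\tau,1])$. For integer $k$: $(\phi|'_kM)(\tau,z)=(c\tau+d)^{-k}\phi(\frac{a\tau+b}{c\tau+d},\frac{z}{c\tau+d})$ for $M=\begin{pmatrix}a&b\\c&d\end{pmatrix}$, and $(\phi|''_k[\lambda\ \mu])(\tau,z)=\big(\psi(\lambda\ \mu)\exp(\eta(\lambda\tau+\mu,[\tau,1])(z+\tfrac12(\lambda\tau+\mu)))\big)^k\phi(\tau,z+\lambda\tau+\mu)$.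 $\rho(\tau,z)=\exp(\tfrac12\eta(1,[\tau,1])z^2-\pi iz)$. $J_k(\Gamma)$ is the space of holomorphic $\phi:\mathfrak{H}\times\mathbb{C}\to\mathbb{C}$ with (i) $\phi|'_kM=\phi$ for $M\in\Gamma$; (ii) $\phi|''_kX=\phi$ for $X\in\mathbb{Z}^2$; (iii) for each $M\in\mathrm{SL}_2(\mathbb{Z})$, $\rho^k(\phi|'_kM)=\sum_{n\ge0}\sum_{|r|\le r_0(n)}c(n,r)q^n\zeta^r$ for some increasing sequence of nonnegative integers $r_0(n)$ with $r_0(n)/n\to0$ (modified Jacobi forms of weight $k$, index $0$). *)

theory Defs
  imports "HOL-Complex_Analysis.Complex_Analysis" "HOL-Algebra.Coset"
begin

definition SL2Z :: "(int ^ 2 ^ 2) monoid" where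
  "SL2Z = \<lparr>carrier = {M. det M = 1}, mult = (\<lambda>A B. A ** B), one = mat 1\<rparr>"

definition finite_index_subgroup :: "'a set \<Rightarrow> ('a, 'b) monoid_scheme \<Rightarrow> bool" where
  "finite_index_subgroup H G \<longleftrightarrow> subgroup H G \<and> finite (rcosets\<^bsub>G\<^esub> H)"

definition upper_half_plane :: "complex set" where
  "upper_half_plane = {\<tau>. Im \<tau> > 0}"

definition e :: "complex \<Rightarrow> complex" where
  "e x = exp (2 * of_real pi * \<i> * x)"

definition period_lattice :: "complex \<Rightarrow> complex \<Rightarrow> complex set" where
  "period_lattice \<omega>1 \<omega>2 = {of_int m * \<omega>1 + of_int n * \<omega>2 | m n. True}"

definition weierstrass_zeta :: "complex \<Rightarrow> complex set \<Rightarrow> complex" where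
  "weierstrass_zeta z L = 1 / z + (\<Sum>\<^sub>\<infinity>\<omega>\<in>L - {0}. 1 / (z - \<omega>) + 1 / \<omega> + z / \<omega>\<^sup>2)"

text \<open>The quasi-period map of \<open>L\<close>, extended \<open>\<real>\<close>-linearly from \<open>L\<close> to the complex plane.
  The extension is unique since a lattice spans the plane over the reals; \<open>linear\<close> means
  real-linear.\<close>
definition weierstrass_eta :: "complex \<Rightarrow> complex set \<Rightarrow> complex" where
  "weierstrass_eta w L = (THE h. linear h \<and>
     (\<forall>\<omega>\<in>L. \<forall>z. z \<notin> L \<longrightarrow> weierstrass_zeta (z + \<omega>) L = weierstrass_zeta z L + h \<omega>)) w"

definition \<psi> :: "complex \<Rightarrow> complex set \<Rightarrow> complex" where
  "\<psi> z L = (if z \<in> L - (\<lambda>\<omega>. 2 * \<omega>) ` L then - 1 else 1)"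

definition aut_factor :: "int ^ 2 ^ 2 \<Rightarrow> complex \<Rightarrow> complex" where
  "aut_factor M \<tau> = of_int (M $ 2 $ 1) * \<tau> + of_int (M $ 2 $ 2)"

definition moebius_act :: "int ^ 2 ^ 2 \<Rightarrow> complex \<Rightarrow> complex" where
  "moebius_act M \<tau> = (of_int (M $ 1 $ 1) * \<tau> + of_int (M $ 1 $ 2)) / aut_factor M \<tau>"

text \<open>The weight \<open>k\<close> actions of a matrix on functions of one variable and of two variables,
  and of a row vector \<open>X = [\<lambda> \<mu>]\<close> on functions of two variables.\<close>

definition slash :: "int \<Rightarrow> (complex \<Rightarrow> complex) \<Rightarrow> int ^ 2 ^ 2 \<Rightarrow> complex \<Rightarrow> complex" where
  "slash k f M \<tau> = aut_factor M \<tau> powi (- k) * f (moebius_act M \<tau>)"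

definition slash_mat ::
    "int \<Rightarrow> (complex \<Rightarrow> complex \<Rightarrow> complex) \<Rightarrow> int ^ 2 ^ 2 \<Rightarrow> complex \<Rightarrow> complex \<Rightarrow> complex" where
  "slash_mat k \<phi> M \<tau> z =
     aut_factor M \<tau> powi (- k) * \<phi> (moebius_act M \<tau>) (z / aut_factor M \<tau>)"

definition slash_vec ::
    "int \<Rightarrow> (complex \<Rightarrow> complex \<Rightarrow> complex) \<Rightarrow> real ^ 2 \<Rightarrow> complex \<Rightarrow> complex \<Rightarrow> complex" where
  "slash_vec k \<phi> X \<tau> z =
     (let L = period_lattice \<tau> 1; x = of_real (X $ 1) * \<tau> + of_real (X $ 2)
      in (\<psi> x L * exp (weierstrass_eta x L * (z + x / 2))) powi k * \<phi> \<tau> (z + x))"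

definition \<rho> :: "complex \<Rightarrow> complex \<Rightarrow> complex" where
  "\<rho> \<tau> z = exp (weierstrass_eta 1 (period_lattice \<tau> 1) * z\<^sup>2 / 2 - of_real pi * \<i> * z)"

text \<open>Holomorphy in two variables: the total derivative exists and is complex-linear.\<close>
definition holomorphic_HC :: "(complex \<Rightarrow> complex \<Rightarrow> complex) \<Rightarrow> bool" where
  "holomorphic_HC \<phi> \<longleftrightarrow>
     (\<forall>\<tau>\<in>upper_half_plane. \<forall>z. \<exists>A B.
        ((\<lambda>(t, w). \<phi> t w) has_derivative (\<lambda>(t, w). A * t + B * w)) (at (\<tau>, z)))"

text \<open>Elements are total functions; only their values for \<open>\<tau>\<close> in the upper half-plane matter.
  ``Increasing'' for \<open>r0\<close> is meant weakly: a strictly increasing sequence of integers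
  cannot satisfy \<open>r0 n / n \<longlonglongrightarrow> 0\<close>.\<close>
definition J :: "int \<Rightarrow> (int ^ 2 ^ 2) set \<Rightarrow> (complex \<Rightarrow> complex \<Rightarrow> complex) set" where
  "J k \<Gamma> = {\<phi>. holomorphic_HC \<phi> \<and>
     (\<forall>M\<in>\<Gamma>. \<forall>\<tau>\<in>upper_half_plane. \<forall>z. slash_mat k \<phi> M \<tau> z = \<phi> \<tau> z) \<and>
     (\<forall>X. (\<forall>i. X $ i \<in> \<int>) \<longrightarrow>
        (\<forall>\<tau>\<in>upper_half_plane. \<forall>z. slash_vec k \<phi> X \<tau> z = \<phi> \<tau> z)) \<and>
     (\<forall>M\<in>carrier SL2Z. \<exists>(r0 :: nat \<Rightarrow> nat) (c :: nat \<Rightarrow> int \<Rightarrow> complex).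
        mono r0 \<and> (\<lambda>n. real (r0 n) / real n) \<longlonglongrightarrow> 0 \<and>
        (\<forall>\<tau>\<in>upper_half_plane. \<forall>z.
           (\<lambda>n. \<Sum>r | \<bar>r\<bar> \<le> int (r0 n). c n r * e \<tau> ^ n * e z powi r)
             sums (\<rho> \<tau> z powi k * slash_mat k \<phi> M \<tau> z)))}"

text \<open>Meromorphy at the cusp \<open>M \<infinity>\<close>: the transform of \<open>f\<close> by \<open>M\<close>, written
  in a local parameter \<open>e (\<tau> / N)\<close> at infinity, is meromorphic at \<open>0\<close>.\<close>
definition nearly_holomorphic_modular_form ::
    "int \<Rightarrow> (int ^ 2 ^ 2) set \<Rightarrow> (complex \<Rightarrow> complex) \<Rightarrow> bool" where
  "nearly_holomorphic_modular_form k \<Gamma> f \<longleftrightarrow>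
     f holomorphic_on upper_half_plane \<and>
     (\<forall>M\<in>\<Gamma>. \<forall>\<tau>\<in>upper_half_plane. slash k f M \<tau> = f \<tau>) \<and>
     (\<forall>M\<in>carrier SL2Z. \<exists>N > 0 :: nat. \<exists>g. g meromorphic_on {0} \<and>
        (\<forall>\<tau>\<in>upper_half_plane. slash k f M \<tau> = g (e (\<tau> / of_nat N))))"

end

theory Submission imports Defs begin

no_notation fps_nth (infixl "$" 75)

text \<open>
  Summing the Weierstrass zeta function of \<open>[\<tau>, 1]\<close> row by row and using the partial fractions of the
  cotangent gives the quasi-periods together with Legendre's relation:
  \<open>\<eta>(\<lambda>\<tau> + \<mu>) = \<eta>(1) (\<lambda>\<tau> + \<mu>) - 2\<pi>i\<lambda>\<close>. With the homogeneity of \<open>\<eta>\<close> it follows that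
  \<open>\<phi>\<^sub>X | M = ((\<phi> | M) | XM)(\<cdot>, 0)\<close>, and that adding to \<open>X \<in> N\<^sup>-\<^sup>1 \<int>\<^sup>2\<close> a vector of \<open>2N \<int>\<^sup>2\<close> does not
  change \<open>\<phi>\<^sub>X\<close>; so \<open>\<phi>\<^sub>X\<close> is invariant under \<open>\<Gamma> \<inter> \<Gamma>(2N\<^sup>2)\<close>.

  In \<open>\<phi>\<^sub>X | M\<close> the factor \<open>exp(\<eta>(1) x\<^sup>2 / 2)\<close> cancels against \<open>\<rho>\<close>, which leaves a monomial in
  \<open>W = e(\<tau> / 2N\<^sup>2)\<close> times the given expansion evaluated at \<open>q = W\<close> to the \<open>2N\<^sup>2\<close> and \<open>\<zeta>\<close> a constant times
  a power of \<open>W\<close>. That expansion converges only pointwise and grouped by powers of \<open>q\<close>; Baire's theorem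
  and Cauchy's estimates turn this into \<open>c(n, r) = O(R\<^sup>n)\<close> for every \<open>R > 1\<close>, because
  \<open>r\<^sub>0(n) = o(n)\<close>. The same condition leaves only finitely many negative powers of \<open>W\<close>.
\<close>

section \<open>Partial fractions of the cotangent\<close>

text \<open>An unordered sum is the limit along every exhaustion by finite sets. The half-open
  windows consist of \<open>0, -1, ..., -(N-1)\<close> and \<open>1, ..., N\<close>, two blocks of
  equal length that will match two digamma series.\<close>

lemma has_sum_int_tendsto:
  assumes "(f has_sum S) (UNIV :: int set)"
  shows "(\<lambda>N. \<Sum>n\<in>{- int N<..int N}. f n) \<longlonglongrightarrow> S"
proof -
  have "filterlim (\<lambda>N. {- int N<..int N}) (finite_subsets_at_top UNIV) sequentially"
    unfolding filterlim_finite_subsets_at_top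
  proof (intro allI impI, elim conjE)
    fix X :: "int set" assume "finite X"
    define B where "B = (\<Sum>x\<in>X. \<bar>x\<bar>) + 1"
    have B: "\<bar>x\<bar> < B" if "x \<in> X" for x
      using member_le_sum[OF that, of abs] \<open>finite X\<close> by (simp add: B_def)
    show "\<forall>\<^sub>F N in sequentially. finite {- int N<..int N} \<and> X \<subseteq> {- int N<..int N} \<and> {- int N<..int N} \<subseteq> UNIV"
      using eventually_ge_at_top[of "nat B"]
      by eventually_elim (use B in force)
  qed
  with assms show ?thesis
    unfolding has_sum_def by (rule filterlim_compose)
qed

text \<open>Both sides of Euler's reflection formula
  \<open>Gamma z * Gamma (1 - z) = pi / sin (pi * z)\<close> are differentiated and
  compared.\<close>

lemma Digamma_reflection_complex:
  fixes z :: complex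
  assumes "z \<notin> \<int>"
  shows "Digamma (1 - z) - Digamma z = of_real pi * cot (of_real pi * z)"
proof -
  have z: "z \<notin> \<int>\<^sub>\<le>\<^sub>0" "1 - z \<notin> \<int>\<^sub>\<le>\<^sub>0"
    using assms nonpos_Ints_Int by (blast, metis Ints_1 Ints_diff assms diff_diff_eq2 add_diff_cancel_left')
  have s: "sin (of_real pi * z) \<noteq> 0"
    using assms by (auto simp: sin_eq_0)
  have "((\<lambda>w. Gamma w * Gamma (1 - w)) has_field_derivative
     (Gamma z * Gamma (1 - z) * (Digamma z - Digamma (1-z)))) (at z)"
    using z by (auto intro!: derivative_eq_intros simp: algebra_simps)
  moreover have "((\<lambda>w. of_real pi / sin (of_real pi * w)) has_field_derivative
     (- of_real pi * (cos (of_real pi * z) * of_real pi) / (sin (of_real pi * z))^2)) (at z)"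
    using s by (auto intro!: derivative_eq_intros simp: power2_eq_square)
  ultimately have "Gamma z * Gamma (1 - z) * (Digamma z - Digamma (1-z)) = - of_real pi * (cos (of_real pi * z) * of_real pi) / (sin (of_real pi * z))^2"
    unfolding Gamma_reflection_complex by (rule DERIV_unique)
  hence "(of_real pi * sin (of_real pi * z)) * ((Digamma z - Digamma (1-z)) * sin (of_real pi * z) + of_real pi * cos (of_real pi * z)) = 0"
    unfolding Gamma_reflection_complex using s by (simp add: field_simps power2_eq_square)
  hence "(Digamma z - Digamma (1-z)) * sin (of_real pi * z) + of_real pi * cos (of_real pi * z) = 0"
    using s by simp
  thus ?thesis using s by (simp add: cot_def field_simps)
qed

text \<open>Subtracting the two digamma limits cancels the logarithms; the two remaining series are
  the blocks \<open>n > 0\<close> and \<open>n \<le> 0\<close> of the window.\<close>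

lemma cot_partial_fractions:
  fixes z :: complex
  assumes "z \<notin> \<int>"
  shows "(\<lambda>N. \<Sum>n\<in>{- int N<..int N}. 1 / (z - of_int n)) \<longlonglongrightarrow> of_real pi * cot (of_real pi * z)"
proof -
  have z: "z \<noteq> 0" "1 - z \<noteq> 0" using assms by auto
  have "(\<lambda>m. (of_real (ln (real m)) - (\<Sum>n<m. inverse (1 - z + of_nat n)))
     - (of_real (ln (real m)) - (\<Sum>n<m. inverse (z + of_nat n)))) \<longlonglongrightarrow> Digamma (1 - z) - Digamma z"
    using z by (intro tendsto_diff Digamma_LIMSEQ)
  moreover have "(of_real (ln (real m)) - (\<Sum>n<m. inverse (1 - z + of_nat n)))
     - (of_real (ln (real m)) - (\<Sum>n<m. inverse (z + of_nat n))) 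
     = (\<Sum>n\<in>{- int m<..int m}. 1 / (z - of_int n))" for m
  proof (induction m)
    case (Suc m)
    have "{- int (Suc m)<..int (Suc m)} = insert (int (Suc m)) (insert (- int m) {- int m<..int m})"
      by auto
    hence "(\<Sum>n\<in>{- int (Suc m)<..int (Suc m)}. 1 / (z - of_int n)) =
      1 / (z - of_int (int (Suc m))) + (1 / (z - of_int (- int m)) + (\<Sum>n\<in>{- int m<..int m}. 1 / (z - of_int n)))"
      by (simp del: of_nat_Suc)
    moreover have "1 / (z - of_int (int (Suc m))) = - inverse (1 - z + of_nat m)"
      by (simp add: divide_simps) (simp add: algebra_simps)
    ultimately show ?case using Suc by (simp add: inverse_eq_divide)
  qed simp
  ultimately show ?thesis using Digamma_reflection_complex[OF assms] by simp
qed

lemma cot_periodic_1: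
  fixes z :: complex
  shows "cot (of_real pi * (z + 1)) = cot (of_real pi * z)"
  by (simp add: cot_def ring_distribs sin_add cos_add)

lemma cot_altdef_exp:
  fixes z :: complex
  shows "cot z = \<i> * (exp (2 * \<i> * z) + 1) / (exp (2 * \<i> * z) - 1)"
proof -
  define E where "E = exp (\<i> * z)"
  have "E \<noteq> 0" by (simp add: E_def)
  have 1: "exp (2 * \<i> * z) = E * E" by (simp add: E_def mult.assoc flip: exp_add)
  have 2: "exp (- (\<i> * z)) = inverse E" by (simp add: exp_minus E_def)
  have 3: "E - inverse E = (E * E - 1) / E" "E + inverse E = (E * E + 1) / E"
    using \<open>E \<noteq> 0\<close> by (simp_all add: field_simps)
  show ?thesis
    unfolding cot_def sin_exp_eq cos_exp_eq 1 2 E_def[symmetric] 3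
    using \<open>E \<noteq> 0\<close> by (auto simp: divide_simps)
qed

text \<open>The cotangent is a fraction in \<open>exp (2 * \<i> * z)\<close>, which tends to
  \<open>0\<close> as the imaginary part grows. The limit in the lower half-plane then follows by
  oddness.\<close>

lemma cot_tendsto_upper:
  fixes g :: "nat \<Rightarrow> complex"
  assumes "filterlim (\<lambda>n. Im (g n)) at_top sequentially"
  shows "(\<lambda>n. cot (of_real pi * g n)) \<longlonglongrightarrow> - \<i>"
proof -
  have "(\<lambda>n. exp (2 * \<i> * (of_real pi * g n))) \<longlonglongrightarrow> 0"
  proof (rule tendsto_norm_zero_cancel)
    have "filterlim (\<lambda>n. - (2 * pi * Im (g n))) at_bot sequentially"
      by (subst filterlim_uminus_at_bot, simp, intro filterlim_tendsto_pos_mult_at_top[OF tendsto_const] assms) auto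
    thus "(\<lambda>n. norm (exp (2 * \<i> * (of_real pi * g n)))) \<longlonglongrightarrow> 0"
      using filterlim_compose[OF exp_at_bot] by (simp add: mult.assoc)
  qed
  hence "(\<lambda>n. \<i> * (exp (2 * \<i> * (of_real pi * g n)) + 1) / (exp (2 * \<i> * (of_real pi * g n)) - 1)) \<longlonglongrightarrow> \<i> * (0 + 1) / (0 - 1)"
    by (intro tendsto_intros) auto
  thus ?thesis by (simp add: cot_altdef_exp)
qed

lemma cot_tendsto_lower:
  fixes g :: "nat \<Rightarrow> complex"
  assumes "filterlim (\<lambda>n. Im (g n)) at_bot sequentially"
  shows "(\<lambda>n. cot (of_real pi * g n)) \<longlonglongrightarrow> \<i>"
proof -
  have "(\<lambda>n. - cot (of_real pi * (- g n))) \<longlonglongrightarrow> - (- \<i>)"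
    by (intro tendsto_minus cot_tendsto_upper) (use assms in \<open>simp add: filterlim_uminus_at_bot\<close>)
  thus ?thesis by (simp add: cot_def)
qed

section \<open>Quasi-periods of the Weierstrass zeta function\<close>

lemma lattice_norm_lower_bound:
  assumes "Im \<tau> > 0"
  obtains c where "c > 0" "\<And>m n :: int. c * max \<bar>real_of_int m\<bar> \<bar>real_of_int n\<bar> \<le> norm (of_int m * \<tau> + of_int n)"
proof -
  define y where "y = Im \<tau>"
  have y: "y > 0" using assms by (simp add: y_def)
  \<comment> \<open>The imaginary part of the lattice point bounds \<open>m\<close> at rate
    \<open>y\<close>; the triangle inequality then bounds \<open>n\<close> at the second
    rate.\<close>
  define c where "c = min y (1 / (1 + norm \<tau> / y))"
  have "c > 0" using y by (auto simp: c_def intro!: divide_pos_pos add_pos_nonneg)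
  have "c * max \<bar>real_of_int m\<bar> \<bar>real_of_int n\<bar> \<le> norm (of_int m * \<tau> + of_int n)" (is "_ \<le> ?w") for m n
  proof -
    have "\<bar>Im (of_int m * \<tau> + of_int n)\<bar> \<le> ?w" by (rule abs_Im_le_cmod)
    hence m: "\<bar>real_of_int m\<bar> * y \<le> ?w" using y by (simp add: y_def abs_mult)
    have "norm (of_int n :: complex) \<le> ?w + norm (of_int m * \<tau>)"
      by (metis add_diff_cancel_left' norm_triangle_ineq4)
    hence "\<bar>real_of_int n\<bar> \<le> ?w + \<bar>real_of_int m\<bar> * norm \<tau>" by (simp add: norm_mult)
    also have "\<dots> \<le> ?w + (?w / y) * norm \<tau>"
      using m y by (intro add_left_mono mult_right_mono) (auto simp: field_simps)
    also have "\<dots> = ?w * (1 + norm \<tau> / y)" by (simp add: algebra_simps)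
    finally have n: "\<bar>real_of_int n\<bar> * (1 / (1 + norm \<tau> / y)) \<le> ?w"
      using y by (simp add: pos_divide_le_eq add_pos_nonneg)
    have "c * \<bar>real_of_int m\<bar> \<le> y * \<bar>real_of_int m\<bar>" by (intro mult_right_mono) (auto simp: c_def)
    moreover have "c * \<bar>real_of_int n\<bar> \<le> (1 / (1 + norm \<tau> / y)) * \<bar>real_of_int n\<bar>"
      by (intro mult_right_mono) (auto simp: c_def)
    ultimately show ?thesis using m n by (auto simp: max_def mult.commute)
  qed
  with \<open>c > 0\<close> show ?thesis by (rule that)
qed

text \<open>The exponent is half of \<open>-3\<close>, so that the product of two such weights
  dominates the inverse cube of a lattice norm. The \<open>max\<close> with \<open>1\<close> keeps
  the weight positive at \<open>0\<close>.\<close>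

lemma summable_on_int_powr:
  "(\<lambda>n::int. max \<bar>real_of_int n\<bar> 1 powr (-3/2)) summable_on UNIV"
proof -
  let ?u = "\<lambda>n::int. max \<bar>real_of_int n\<bar> 1 powr (-3/2)"
  have "summable (\<lambda>n::nat. real n powr (-3/2))" by (simp add: summable_real_powr_iff)
  hence "summable (\<lambda>n::nat. real (Suc n) powr (-3/2))" by (subst summable_Suc_iff)
  moreover have "?u (int (Suc n)) = real (Suc n) powr (-3/2)" for n by (simp add: max_def)
  ultimately have "summable (\<lambda>n::nat. ?u (int (Suc n)))" by (simp only:)
  hence "summable (\<lambda>n::nat. ?u (int n))" by (subst (asm) summable_Suc_iff)
  hence 1: "(\<lambda>n::nat. ?u (int n)) summable_on UNIV"
    by (subst summable_on_UNIV_nonneg_real_iff) auto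
  have "?u summable_on range int"
    by (subst summable_on_reindex) (use 1 in \<open>simp_all add: o_def\<close>)
  moreover have "?u summable_on range (\<lambda>n. - int n)"
    by (subst summable_on_reindex) (use 1 in \<open>simp_all add: o_def inj_on_def\<close>)
  moreover have "(UNIV::int set) = range int \<union> range (\<lambda>n. - int n)"
    by (auto simp: image_iff) (metis int_cases2)
  ultimately show ?thesis by (metis summable_on_union)
qed

lemma summable_on_lattice_norm_cubed:
  assumes "Im \<tau> > 0"
  shows "(\<lambda>(m, n). 1 / norm (of_int m * \<tau> + of_int n) ^ 3) summable_on UNIV \<times> UNIV"
proof -
  let ?u = "\<lambda>n::int. max \<bar>real_of_int n\<bar> 1 powr (-3/2)"
  obtain c where c: "c > 0" "\<And>m n :: int. c * max \<bar>real_of_int m\<bar> \<bar>real_of_int n\<bar> \<le> norm (of_int m * \<tau> + of_int n)"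
    using lattice_norm_lower_bound[OF assms] by blast
  have "(\<lambda>(m, n). ?u m * ?u n) summable_on UNIV \<times> UNIV"
  proof (rule summable_on_SigmaI)
    show "((\<lambda>n. case (m, n) of (m, n) \<Rightarrow> ?u m * ?u n) has_sum (?u m * infsum ?u UNIV)) UNIV" for m
      using summable_on_int_powr by (auto intro!: has_sum_cmult_right)
    show "(\<lambda>m. ?u m * infsum ?u UNIV) summable_on UNIV"
      by (intro summable_on_cmult_left summable_on_int_powr)
  qed auto
  hence "(\<lambda>x. (1 / c ^ 3) * (case x of (m, n) \<Rightarrow> ?u m * ?u n)) summable_on UNIV \<times> UNIV"
    by (rule summable_on_cmult_right)
  thus ?thesis
  proof (rule summable_on_comparison_test; safe)
    fix m n :: int
    let ?w = "norm (of_int m * \<tau> + of_int n)"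
    let ?a = "max \<bar>real_of_int m\<bar> 1" and ?b = "max \<bar>real_of_int n\<bar> 1"
    show "1 / ?w ^ 3 \<le> 1 / c ^ 3 * (?u m * ?u n)"
    \<comment> \<open>At the origin the left-hand side is \<open>0\<close>, since
      \<open>1 / 0 = 0\<close>.\<close>
    proof (cases "m = 0 \<and> n = 0")
      case False
      define x where "x = max \<bar>real_of_int m\<bar> \<bar>real_of_int n\<bar>"
      have x: "x \<ge> ?a" "x \<ge> ?b" "x \<ge> 1" using False by (auto simp: x_def)
      have "?a powr (3/2) * ?b powr (3/2) \<le> x powr (3/2) * x powr (3/2)"
        using x by (intro mult_mono powr_mono2) auto
      also have "\<dots> = x powr 3" by (subst powr_add[symmetric]) simp
      also have "\<dots> = x ^ 3" using x by simp
      finally have "c ^ 3 * (?a powr (3/2) * ?b powr (3/2)) \<le> c ^ 3 * x ^ 3" using c by simp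
      also have "\<dots> = (c * x) ^ 3" by (simp add: power_mult_distrib)
      also have "\<dots> \<le> ?w ^ 3" using c x by (intro power_mono) (auto simp: x_def)
      finally have *: "c ^ 3 * (?a powr (3/2) * ?b powr (3/2)) \<le> ?w ^ 3" .
      have "0 < c * x" using c x by simp
      hence w0: "?w > 0" using c(2)[of m n] unfolding x_def by (rule less_le_trans)
      have "1 / ?w ^ 3 \<le> 1 / (c ^ 3 * (?a powr (3/2) * ?b powr (3/2)))"
        using c w0 by (intro divide_left_mono[OF *] mult_pos_pos) auto
      also have "\<dots> = 1 / c ^ 3 * (?u m * ?u n)" by (simp add: powr_minus_divide)
      finally show ?thesis .
    qed (use c in auto)
  qed auto
qed

text \<open>Since \<open>1 / 0 = 0\<close>, the value at \<open>\<omega> = 0\<close> is \<open>1 / z\<close>, so that summing over the whole lattice gives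
  \<open>weierstrass_zeta\<close>.\<close>
definition zeta_term :: "complex \<Rightarrow> complex \<Rightarrow> complex" where
  "zeta_term z \<omega> = 1 / (z - \<omega>) + 1 / \<omega> + z / \<omega>\<^sup>2"

text \<open>Over a common denominator the term is \<open>z^2 / (w^2 * (z - w))\<close>, of the order
  of the inverse cube of \<open>norm w\<close> outside a finite set. That set absorbs any
  pole.\<close>

lemma summable_on_zeta_term:
  assumes "Im \<tau> > 0"
  shows "(\<lambda>(m, n). zeta_term z (of_int m * \<tau> + of_int n)) summable_on UNIV \<times> UNIV"
proof -
  let ?w = "\<lambda>m n. of_int m * \<tau> + of_int n"
  obtain c where c: "c > 0" "\<And>m n :: int. c * max \<bar>real_of_int m\<bar> \<bar>real_of_int n\<bar> \<le> norm (?w m n)"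
    using lattice_norm_lower_bound[OF assms] by blast
  \<comment> \<open>Outside \<open>F\<close> the lattice point is nonzero and its distance from
    \<open>z\<close> is at least half its norm.\<close>
  define F where "F = {(m, n). norm (?w m n) < 2 * norm z + 1}"
  define B where "B = \<lceil>(2 * norm z + 1) / c\<rceil>"
  have "F \<subseteq> {-B..B} \<times> {-B..B}"
  proof safe
    fix m n assume "(m, n) \<in> F"
    hence "c * max \<bar>real_of_int m\<bar> \<bar>real_of_int n\<bar> < 2 * norm z + 1"
      using c(2)[of m n] by (simp add: F_def)
    hence "max \<bar>real_of_int m\<bar> \<bar>real_of_int n\<bar> < (2 * norm z + 1) / c"
      using c(1) by (simp only: pos_less_divide_eq mult.commute)
    hence "max \<bar>real_of_int m\<bar> \<bar>real_of_int n\<bar> \<le> of_int B" unfolding B_def by linarith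
    thus "m \<in> {-B..B}" "n \<in> {-B..B}" by auto
  qed
  hence "finite F" by (rule finite_subset) auto
  have "(\<lambda>x. (2 * norm z ^ 2) * (case x of (m, n) \<Rightarrow> 1 / norm (?w m n) ^ 3)) summable_on UNIV \<times> UNIV"
    by (intro summable_on_cmult_right summable_on_lattice_norm_cubed assms)
  hence "(\<lambda>x. (2 * norm z ^ 2) * (case x of (m, n) \<Rightarrow> 1 / norm (?w m n) ^ 3)) summable_on - F"
    by (rule summable_on_subset) auto
  hence "(\<lambda>x. norm (case x of (m, n) \<Rightarrow> zeta_term z (?w m n))) summable_on - F"
  proof (rule Infinite_Sum.abs_summable_on_comparison_test'; safe)
    fix m n assume "(m, n) \<notin> F"
    define w where "w = ?w m n"
    have w: "norm w \<ge> 2 * norm z + 1" using \<open>(m, n) \<notin> F\<close> by (simp add: F_def w_def)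
    have w0: "norm w > 0" using w norm_ge_zero[of z] by linarith
    hence "w \<noteq> 0" by simp
    have "norm (z - w) \<ge> norm w - norm z" by (metis norm_minus_commute norm_triangle_ineq2)
    hence zw: "norm (z - w) \<ge> norm w / 2" using w by (simp add: field_simps)
    hence "norm (z - w) > 0" using w0 by linarith
    hence "z - w \<noteq> 0" by simp
    have "zeta_term z w = z ^ 2 / (w ^ 2 * (z - w))"
      using \<open>w \<noteq> 0\<close> \<open>z - w \<noteq> 0\<close> unfolding zeta_term_def
      by (simp add: divide_simps) (simp add: power2_eq_square algebra_simps)
    also have "norm \<dots> = norm z ^ 2 / (norm w ^ 2 * norm (z - w))"
      by (simp add: norm_divide norm_mult norm_power)
    also have "\<dots> \<le> norm z ^ 2 / (norm w ^ 2 * (norm w / 2))"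
      using \<open>w \<noteq> 0\<close> \<open>z - w \<noteq> 0\<close> zw by (intro divide_left_mono mult_left_mono mult_pos_pos) auto
    also have "\<dots> = 2 * norm z ^ 2 * (1 / norm w ^ 3)" by (simp add: power2_eq_square power3_eq_cube)
    finally show "norm (zeta_term z (?w m n)) \<le> 2 * norm z ^ 2 * (1 / norm (?w m n) ^ 3)"
      by (simp only: w_def)
  qed
  hence "(\<lambda>(m, n). zeta_term z (?w m n)) summable_on - F" by (rule abs_summable_summable)
  moreover have "(\<lambda>(m, n). zeta_term z (?w m n)) summable_on F" using \<open>finite F\<close> by simp
  ultimately have "(\<lambda>(m, n). zeta_term z (?w m n)) summable_on - F \<union> F"
    by (intro summable_on_Un_disjoint) auto
  thus ?thesis by simp
qed

section \<open>Lattice coordinates and the zeta function as a sum over integer pairs\<close>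

lemma lattice_coords_inj:
  assumes "Im \<tau> > 0" "of_real a * \<tau> + of_real b = of_real a' * \<tau> + of_real b'"
  shows "a = a' \<and> b = b'"
proof -
  have "Im (of_real a * \<tau> + of_real b) = Im (of_real a' * \<tau> + of_real b')" using assms by simp
  hence "a = a'" using assms(1) by simp
  thus ?thesis using assms(2) by simp
qed

lemma inj_lattice_param:
  assumes "Im \<tau> > 0"
  shows "inj (\<lambda>(m :: int, n :: int). of_int m * \<tau> + of_int n)"
proof (rule injI, clarify)
  fix m n m' n' :: int assume "of_int m * \<tau> + of_int n = of_int m' * \<tau> + of_int n'"
  thus "m = m' \<and> n = n'" using lattice_coords_inj[OF assms, of "of_int m" "of_int n" "of_int m'" "of_int n'"] by simp
qed

lemma period_lattice_altdef:
  "period_lattice \<tau> 1 = (\<lambda>(m, n). of_int m * \<tau> + of_int n) ` (UNIV \<times> UNIV)"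
  by (auto simp: period_lattice_def image_def)

text \<open>Indexing by coordinate pairs is what permits the later summation row by row.\<close>

lemma has_sum_weierstrass_zeta:
  assumes "Im \<tau> > 0"
  shows "((\<lambda>(m, n). zeta_term z (of_int m * \<tau> + of_int n)) has_sum weierstrass_zeta z (period_lattice \<tau> 1)) (UNIV \<times> UNIV)"
proof -
  let ?L = "period_lattice \<tau> 1"
  have s: "zeta_term z summable_on ?L"
    unfolding period_lattice_altdef
    by (subst summable_on_reindex)
       (use inj_lattice_param[OF assms] summable_on_zeta_term[OF assms] in \<open>auto simp: o_def case_prod_unfold\<close>)
  have 0: "0 \<in> ?L" unfolding period_lattice_def by (auto intro!: exI[of _ 0])
  have "infsum (zeta_term z) (insert 0 (?L - {0})) = zeta_term z 0 + infsum (zeta_term z) (?L - {0})"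
    by (rule infsum_insert) (auto intro: summable_on_subset_banach[OF s])
  hence "infsum (zeta_term z) ?L = weierstrass_zeta z ?L"
    using 0 by (simp add: insert_absorb weierstrass_zeta_def zeta_term_def[abs_def])
  hence "(zeta_term z has_sum weierstrass_zeta z ?L) ?L" using s by (metis has_sum_infsum)
  thus ?thesis unfolding period_lattice_altdef
    by (subst (asm) has_sum_reindex)
       (use inj_lattice_param[OF assms] in \<open>auto simp: o_def case_prod_unfold\<close>)
qed

lemma period_lattice_iff:
  assumes "Im \<tau> > 0"
  shows "of_real a * \<tau> + of_real b \<in> period_lattice \<tau> 1 \<longleftrightarrow> a \<in> \<int> \<and> b \<in> \<int>"
proof
  assume "of_real a * \<tau> + of_real b \<in> period_lattice \<tau> 1"
  then obtain m n :: int where "of_real a * \<tau> + of_real b = of_int m * \<tau> + of_int n"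
    by (auto simp: period_lattice_def)
  thus "a \<in> \<int> \<and> b \<in> \<int>" using lattice_coords_inj[OF assms, of a b "of_int m" "of_int n"] by simp
next
  assume "a \<in> \<int> \<and> b \<in> \<int>"
  thus "of_real a * \<tau> + of_real b \<in> period_lattice \<tau> 1"
    by (force simp: period_lattice_def elim!: Ints_cases)
qed

lemma add_in_period_lattice:
  assumes "z \<in> period_lattice \<tau> 1" "w \<in> period_lattice \<tau> 1"
  shows "z + w \<in> period_lattice \<tau> 1"
proof -
  obtain m n m' n' :: int where "z = of_int m * \<tau> + of_int n" "w = of_int m' * \<tau> + of_int n'"
    using assms by (auto simp: period_lattice_def)
  hence "z + w = of_int (m + m') * \<tau> + of_int (n + n') * 1" by (simp add: algebra_simps)
  thus ?thesis unfolding period_lattice_def by blast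
qed

text \<open>This makes the partial fractions of the cotangent available in every row.\<close>

lemma not_in_period_lattice_imp_not_Ints:
  assumes "z \<notin> period_lattice \<tau> 1"
  shows "z - of_int m * \<tau> \<notin> \<int>"
proof
  assume "z - of_int m * \<tau> \<in> \<int>"
  then obtain n where "z - of_int m * \<tau> = of_int n" by (auto elim: Ints_cases)
  hence "z = of_int m * \<tau> + of_int n * 1" by (simp add: algebra_simps)
  thus False using assms unfolding period_lattice_def by blast
qed

lemma period_lattice_complement:
  assumes "Im \<tau> > 0"
  obtains z where "z \<notin> period_lattice \<tau> 1"
proof -
  have "(1/2 :: real) \<notin> \<int>" using fraction_not_in_Ints[of 2 1, where 'a = real] by simp
  hence "of_real (1/2) * \<tau> + of_real 0 \<notin> period_lattice \<tau> 1" by (subst period_lattice_iff[OF assms]) simp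
  thus ?thesis by (rule that)
qed

text \<open>In row \<open>m\<close>, a shift by \<open>s\<close> changes the sum by a difference of
  cotangents plus \<open>s\<close> times the row sum of \<open>1 / \<omega>^2\<close>. For
  \<open>s = 1\<close> the cotangents cancel by periodicity; for \<open>s = \<tau>\<close> they
  telescope over the rows, and their limits at both ends leave \<open>- 2 * pi * \<i>\<close>. This
  is Legendre's relation.\<close>

lemma weierstrass_zeta_add_1_tau:
  assumes "Im \<tau> > 0"
  obtains \<alpha> where
    "\<And>z. z \<notin> period_lattice \<tau> 1 \<Longrightarrow>
       weierstrass_zeta (z + 1) (period_lattice \<tau> 1) = weierstrass_zeta z (period_lattice \<tau> 1) + \<alpha>"
    "\<And>z. z \<notin> period_lattice \<tau> 1 \<Longrightarrow>
       weierstrass_zeta (z + \<tau>) (period_lattice \<tau> 1) =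
         weierstrass_zeta z (period_lattice \<tau> 1) + (\<alpha> * \<tau> - 2 * of_real pi * \<i>)"
proof -
  let ?L = "period_lattice \<tau> 1" and ?w = "\<lambda>m n :: int. of_int m * \<tau> + of_int n"
  let ?pi = "of_real pi :: complex"
  define R where "R = (\<lambda>z m. \<Sum>\<^sub>\<infinity>n. zeta_term z (?w m n))"
  have row: "((\<lambda>n. zeta_term z (?w m n)) has_sum R z m) UNIV" for z m
    unfolding R_def using summable_on_SigmaD1[OF summable_on_zeta_term[OF assms, of z], of m]
    by (intro has_sum_infsum) simp
  have rows: "(R z has_sum weierstrass_zeta z ?L) UNIV" for z
    by (rule has_sum_Sigma'[OF has_sum_weierstrass_zeta[OF assms]]) (use row in auto)
  define E where "E = (\<lambda>m N. \<Sum>n\<in>{- int N<..int N}. 1 / (?w m n)\<^sup>2)"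
  \<comment> \<open>\<open>E m\<close> need not be known to converge: convergence falls out of the case \<open>s = 1\<close>,
      where the cotangents cancel.\<close>
  have diff: "(\<lambda>N. ?pi * cot (?pi * (z + s - of_int m * \<tau>)) - ?pi * cot (?pi * (z - of_int m * \<tau>)) + s * E m N)
       \<longlonglongrightarrow> R (z + s) m - R z m"
    if "z \<notin> ?L" "z + s \<notin> ?L" for z s m
  proof -
    let ?S = "\<lambda>f N. \<Sum>n\<in>{- int N<..int N}. f n :: complex"
    let ?C = "\<lambda>z. ?pi * cot (?pi * (z - of_int m * \<tau>))"
    have "(\<lambda>N. ?S (\<lambda>n. zeta_term (z + s) (?w m n)) N - ?S (\<lambda>n. zeta_term z (?w m n)) N)
       \<longlonglongrightarrow> R (z + s) m - R z m"
      by (intro tendsto_diff has_sum_int_tendsto row)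
    \<comment> \<open>A null sequence; adding it trades the truncated partial fractions for the
      cotangents themselves.\<close>
    moreover have "(\<lambda>N. ?C (z + s) - ?S (\<lambda>n. 1 / (z + s - of_int m * \<tau> - of_int n)) N
        - (?C z - ?S (\<lambda>n. 1 / (z - of_int m * \<tau> - of_int n)) N))
       \<longlonglongrightarrow> ?C (z + s) - ?C (z + s) - (?C z - ?C z)"
      by (intro tendsto_diff tendsto_const cot_partial_fractions not_in_period_lattice_imp_not_Ints that)
    ultimately have lim: "(\<lambda>N. (?S (\<lambda>n. zeta_term (z + s) (?w m n)) N - ?S (\<lambda>n. zeta_term z (?w m n)) N)
       + (?C (z + s) - ?S (\<lambda>n. 1 / (z + s - of_int m * \<tau> - of_int n)) N
        - (?C z - ?S (\<lambda>n. 1 / (z - of_int m * \<tau> - of_int n)) N)))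
       \<longlonglongrightarrow> R (z + s) m - R z m + (?C (z + s) - ?C (z + s) - (?C z - ?C z))"
      by (rule tendsto_add)
    have eq: "?S (\<lambda>n. zeta_term (z + s) (?w m n)) N - ?S (\<lambda>n. zeta_term z (?w m n)) N =
       ?S (\<lambda>n. 1 / (z + s - of_int m * \<tau> - of_int n)) N - ?S (\<lambda>n. 1 / (z - of_int m * \<tau> - of_int n)) N
       + s * E m N" for N
      unfolding E_def sum_distrib_left sum_subtractf[symmetric] sum.distrib[symmetric]
      by (intro sum.cong refl) (simp add: zeta_term_def algebra_simps add_divide_distrib)
    show ?thesis using lim unfolding eq by (simp add: algebra_simps)
  qed
  have E_lim: "E m \<longlonglongrightarrow> R (z + 1) m - R z m" if "z \<notin> ?L" for z m
  proof -
    have "z + 1 \<notin> ?L"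
      using that add_in_period_lattice[of "z + 1" \<tau> "- 1"] period_lattice_iff[OF assms, of 0 "- 1"] by auto
    moreover have "cot (?pi * (z + 1 - of_int m * \<tau>)) = cot (?pi * (z - of_int m * \<tau>))"
      using cot_periodic_1[of "z - of_int m * \<tau>"] by (simp add: algebra_simps)
    ultimately show ?thesis using diff[OF that, of 1 m] by simp
  qed
  obtain z0 where z0: "z0 \<notin> ?L" using period_lattice_complement[OF assms] .
  define \<alpha> where "\<alpha> = weierstrass_zeta (z0 + 1) ?L - weierstrass_zeta z0 ?L"
  define E0 where "E0 = (\<lambda>m. R (z0 + 1) m - R z0 m)"
  have has_sum_diff: "((\<lambda>m. f m - g m) has_sum (a - b)) UNIV" if "(f has_sum a) UNIV" "(g has_sum b) UNIV"
    for f g :: "int \<Rightarrow> complex" and a b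
    using has_sum_add[OF that(1) has_sum_uminusI[OF that(2)]] by simp
  have E0: "(E0 has_sum \<alpha>) UNIV" unfolding E0_def \<alpha>_def by (intro has_sum_diff rows)
  \<comment> \<open>Both sides are limits of \<open>E m\<close>, which does not involve
    \<open>z\<close>.\<close>
  have E0_eq: "R (z + 1) m - R z m = E0 m" if "z \<notin> ?L" for z m
    using E_lim[OF that, of m] E_lim[OF z0, of m] unfolding E0_def by (rule LIMSEQ_unique)
  show ?thesis
  proof (rule that[of \<alpha>])
    fix z assume z: "z \<notin> ?L"
    have "(E0 has_sum (weierstrass_zeta (z + 1) ?L - weierstrass_zeta z ?L)) UNIV"
      using has_sum_diff[OF rows[of "z + 1"] rows[of z]] by (simp add: E0_eq[OF z])
    with E0 have "\<alpha> = weierstrass_zeta (z + 1) ?L - weierstrass_zeta z ?L" by (rule has_sum_unique)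
    thus "weierstrass_zeta (z + 1) ?L = weierstrass_zeta z ?L + \<alpha>" by simp
  next
    fix z assume z: "z \<notin> ?L"
    let ?D = "weierstrass_zeta (z + \<tau>) ?L - weierstrass_zeta z ?L"
    define C where "C = (\<lambda>m. ?pi * cot (?pi * (z - of_int m * \<tau>)))"
    have zt: "z + \<tau> \<notin> ?L"
      using z add_in_period_lattice[of "z + \<tau>" \<tau> "- \<tau>"] period_lattice_iff[OF assms, of "-1" 0] by auto
    \<comment> \<open>Shifting \<open>z\<close> by \<open>\<tau>\<close> in row \<open>m\<close>
      gives the cotangent of row \<open>m - 1\<close>.\<close>
    have Rd: "R (z + \<tau>) m - R z m = C (m - 1) - C m + \<tau> * E0 m" for m
    proof -
      have "(\<lambda>N. C (m - 1) - C m + \<tau> * E m N) \<longlonglongrightarrow> R (z + \<tau>) m - R z m"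
        using diff[OF z zt, of m] by (simp add: C_def algebra_simps)
      moreover have "(\<lambda>N. C (m - 1) - C m + \<tau> * E m N) \<longlonglongrightarrow> C (m - 1) - C m + \<tau> * E0 m"
        using E_lim[OF z, of m] unfolding E0_eq[OF z] by (intro tendsto_intros)
      ultimately show ?thesis by (rule LIMSEQ_unique)
    qed
    have "((\<lambda>m. (R (z + \<tau>) m - R z m) - \<tau> * E0 m) has_sum (?D - \<tau> * \<alpha>)) UNIV"
      by (intro has_sum_diff rows has_sum_cmult_right E0)
    hence "((\<lambda>m. C (m - 1) - C m) has_sum (?D - \<tau> * \<alpha>)) UNIV" by (simp add: Rd)
    hence "(\<lambda>N. \<Sum>m\<in>{- int N<..int N}. C (m - 1) - C m) \<longlonglongrightarrow> ?D - \<tau> * \<alpha>"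
      by (rule has_sum_int_tendsto)
    moreover have "(\<Sum>m\<in>{- int N<..int N}. C (m - 1) - C m) = C (- int N) - C (int N)" for N
    proof (induction N)
      case (Suc N)
      have "{- int (Suc N)<..int (Suc N)} = insert (int (Suc N)) (insert (- int N) {- int N<..int N})"
        by auto
      moreover have "C (- int N - 1) = C (- int (Suc N))" "C (int (Suc N) - 1) = C (int N)"
        by (rule arg_cong[of _ _ C]; simp)+
      ultimately show ?case using Suc by (simp del: of_nat_Suc)
    qed simp
    \<comment> \<open>The first argument runs to the top of the plane, where the cotangent tends to
      \<open>-\<i>\<close>, the second to the bottom, where it tends to \<open>\<i>\<close>.\<close>
    moreover have "(\<lambda>N. C (- int N) - C (int N)) \<longlonglongrightarrow> ?pi * (- \<i>) - ?pi * \<i>"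
      unfolding C_def
    proof (intro tendsto_diff tendsto_mult tendsto_const cot_tendsto_upper cot_tendsto_lower)
      have *: "filterlim (\<lambda>N. real N * Im \<tau>) at_top sequentially"
        using assms by (intro filterlim_at_top_mult_tendsto_pos[OF tendsto_const] filterlim_real_sequentially)
      show "filterlim (\<lambda>N. Im (z - of_int (- int N) * \<tau>)) at_top sequentially"
        using filterlim_tendsto_add_at_top[OF tendsto_const *, of "Im z"] by simp
      show "filterlim (\<lambda>N. Im (z - of_int (int N) * \<tau>)) at_bot sequentially"
        using filterlim_tendsto_add_at_top[OF tendsto_const *, of "- Im z"]
        by (simp add: filterlim_uminus_at_bot algebra_simps)
    qed
    ultimately have "?D - \<tau> * \<alpha> = ?pi * (- \<i>) - ?pi * \<i>"
      by (simp only:) (rule LIMSEQ_unique)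
    thus "weierstrass_zeta (z + \<tau>) ?L = weierstrass_zeta z ?L + (\<alpha> * \<tau> - 2 * ?pi * \<i>)"
      by (simp add: algebra_simps)
  qed
qed

section \<open>From the two basic periods to the real-linear quasi-period map\<close>

lemma additive_int_multiple:
  fixes F :: "complex \<Rightarrow> complex"
  assumes F: "\<And>z. z \<notin> period_lattice \<tau> 1 \<Longrightarrow> F (z + p) = F z + a"
    and p: "p \<in> period_lattice \<tau> 1" "- p \<in> period_lattice \<tau> 1"
    and z: "z \<notin> period_lattice \<tau> 1"
  shows "z + of_int n * p \<notin> period_lattice \<tau> 1 \<and> F (z + of_int n * p) = F z + of_int n * a"
\<comment> \<open>Staying outside the lattice is part of the induction, because the functional
  equation is only given there.\<close>
proof (induction n rule: int_induct[of _ 0])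
  case base
  show ?case using z by simp
next
  case (step1 i)
  have eq: "z + of_int (i + 1) * p = (z + of_int i * p) + p" by (simp add: algebra_simps)
  have "z + of_int i * p + p \<notin> period_lattice \<tau> 1"
    using step1 add_in_period_lattice[OF _ p(2), of "z + of_int i * p + p"] by auto
  thus ?case unfolding eq using F[of "z + of_int i * p"] step1 by (simp add: algebra_simps)
next
  case (step2 i)
  define w where "w = z + of_int (i - 1) * p"
  have eq: "z + of_int i * p = w + p" by (simp add: w_def algebra_simps)
  have w: "w \<notin> period_lattice \<tau> 1"
    using step2 add_in_period_lattice[OF _ p(1), of w] unfolding eq by auto
  have "F (w + p) = F w + a" by (rule F[OF w])
  with step2 w show ?case unfolding eq w_def[symmetric] by (simp add: algebra_simps)
qed

text \<open>The definite description needs uniqueness: a real-linear map is determined by its values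
  at \<open>\<tau>\<close> and \<open>1\<close>, and these are read off at a single point outside
  the lattice.\<close>

lemma weierstrass_eta_eqI:
  assumes "Im \<tau> > 0" "linear h"
    and "\<And>\<omega> z. \<omega> \<in> period_lattice \<tau> 1 \<Longrightarrow> z \<notin> period_lattice \<tau> 1 \<Longrightarrow>
      weierstrass_zeta (z + \<omega>) (period_lattice \<tau> 1) = weierstrass_zeta z (period_lattice \<tau> 1) + h \<omega>"
  shows "weierstrass_eta w (period_lattice \<tau> 1) = h w"
proof -
  let ?L = "period_lattice \<tau> 1"
  have "(THE h. linear h \<and> (\<forall>\<omega>\<in>?L. \<forall>z. z \<notin> ?L \<longrightarrow>
     weierstrass_zeta (z + \<omega>) ?L = weierstrass_zeta z ?L + h \<omega>)) = h"
  proof (rule the_equality)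
    fix g assume g: "linear g \<and> (\<forall>\<omega>\<in>?L. \<forall>z. z \<notin> ?L \<longrightarrow>
     weierstrass_zeta (z + \<omega>) ?L = weierstrass_zeta z ?L + g \<omega>)"
    obtain z where z: "z \<notin> ?L" using period_lattice_complement[OF assms(1)] .
    have eq: "g \<omega> = h \<omega>" if "\<omega> \<in> ?L" for \<omega> using assms(3)[OF that z] g that z by auto
    have gh: "g \<tau> = h \<tau>" "g 1 = h 1"
      using period_lattice_iff[OF assms(1), of 1 0] period_lattice_iff[OF assms(1), of 0 1]
      by (simp_all add: eq)
    have coords: "f x = (Im x / Im \<tau>) *\<^sub>R f \<tau> + (Re x - Im x / Im \<tau> * Re \<tau>) *\<^sub>R f 1"
      if "linear f" for f :: "complex \<Rightarrow> complex" and x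
    proof -
      have "x = (Im x / Im \<tau>) *\<^sub>R \<tau> + (Re x - Im x / Im \<tau> * Re \<tau>) *\<^sub>R 1"
        using assms by (simp add: complex_eq_iff)
      hence "f x = f ((Im x / Im \<tau>) *\<^sub>R \<tau> + (Re x - Im x / Im \<tau> * Re \<tau>) *\<^sub>R 1)" by simp
      thus ?thesis by (simp only: linear_add[OF that] linear_scale[OF that])
    qed
    show "g = h"
    proof
      fix x show "g x = h x"
        using coords[of g x] coords[OF assms(2), of x] g gh by simp
    qed
  qed (use assms in auto)
  thus ?thesis unfolding weierstrass_eta_def by simp
qed

text \<open>The term with \<open>Im w / Im \<tau>\<close> encodes Legendre's relation.\<close>
lemma weierstrass_eta_formula:
  assumes "Im \<tau> > 0"
  obtains \<alpha> where
    "\<And>w. weierstrass_eta w (period_lattice \<tau> 1) = \<alpha> * w - 2 * of_real pi * \<i> * of_real (Im w / Im \<tau>)"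
    "\<And>\<omega> z. \<omega> \<in> period_lattice \<tau> 1 \<Longrightarrow> z \<notin> period_lattice \<tau> 1 \<Longrightarrow>
      weierstrass_zeta (z + \<omega>) (period_lattice \<tau> 1) =
        weierstrass_zeta z (period_lattice \<tau> 1) + weierstrass_eta \<omega> (period_lattice \<tau> 1)"
proof -
  let ?L = "period_lattice \<tau> 1"
  obtain \<alpha> where \<alpha>: "\<And>z. z \<notin> ?L \<Longrightarrow> weierstrass_zeta (z + 1) ?L = weierstrass_zeta z ?L + \<alpha>"
    "\<And>z. z \<notin> ?L \<Longrightarrow> weierstrass_zeta (z + \<tau>) ?L = weierstrass_zeta z ?L + (\<alpha> * \<tau> - 2 * of_real pi * \<i>)"
    using weierstrass_zeta_add_1_tau[OF assms] by blast
  \<comment> \<open>For \<open>w = a * \<tau> + b\<close> with real \<open>a\<close>,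
    \<open>b\<close> the quotient \<open>Im w / Im \<tau>\<close> is \<open>a\<close>; hence
    \<open>h\<close> is the real-linear map with the two values just obtained at \<open>1\<close>
    and \<open>\<tau>\<close>.\<close>
  define h where "h = (\<lambda>w. \<alpha> * w - 2 * of_real pi * \<i> * of_real (Im w / Im \<tau>))"
  have "linear h"
    by (rule linearI) (simp_all add: h_def algebra_simps add_divide_distrib scaleR_conv_of_real)
  have h: "weierstrass_zeta (z + \<omega>) ?L = weierstrass_zeta z ?L + h \<omega>"
    if "\<omega> \<in> ?L" "z \<notin> ?L" for \<omega> z
  proof -
    obtain m n :: int where mn: "\<omega> = of_int m * \<tau> + of_int n * 1"
      using \<open>\<omega> \<in> ?L\<close> unfolding period_lattice_def by blast
    have 1: "z + of_int m * \<tau> \<notin> ?L \<and> weierstrass_zeta (z + of_int m * \<tau>) ?L =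
       weierstrass_zeta z ?L + of_int m * (\<alpha> * \<tau> - 2 * of_real pi * \<i>)"
      by (rule additive_int_multiple[where F = "\<lambda>z. weierstrass_zeta z ?L", OF \<alpha>(2) _ _ that(2)])
         (use period_lattice_iff[OF assms, of 1 0] period_lattice_iff[OF assms, of "-1" 0] in auto)
    have "z + of_int m * \<tau> + of_int n * 1 \<notin> ?L \<and> weierstrass_zeta (z + of_int m * \<tau> + of_int n * 1) ?L =
       weierstrass_zeta (z + of_int m * \<tau>) ?L + of_int n * \<alpha>"
      by (rule additive_int_multiple[where F = "\<lambda>z. weierstrass_zeta z ?L", OF \<alpha>(1)])
         (use 1 period_lattice_iff[OF assms, of 0 1] period_lattice_iff[OF assms, of 0 "-1"] in auto)
    moreover have im: "Im \<omega> / Im \<tau> = of_int m" using assms by (simp add: mn)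
    have "h \<omega> = of_int m * (\<alpha> * \<tau> - 2 * of_real pi * \<i>) + of_int n * \<alpha>"
      unfolding h_def im by (simp add: mn algebra_simps)
    ultimately show ?thesis using 1 by (simp add: mn add.assoc)
  qed
  have eta: "weierstrass_eta w ?L = h w" for w
    by (rule weierstrass_eta_eqI[OF assms \<open>linear h\<close> h])
  show ?thesis by (rule that[of \<alpha>]) (use eta h in \<open>simp_all add: h_def\<close>)
qed

section \<open>Homogeneity of the zeta function and of its quasi-periods\<close>

lemma weierstrass_zeta_scale:
  assumes "c \<noteq> 0"
  shows "weierstrass_zeta (c * z) ((*) c ` L) = weierstrass_zeta z L / c"
proof -
  have "(*) c ` L - {0} = (*) c ` (L - {0})" using assms by auto
  moreover have "infsum (\<lambda>\<omega>. 1 / (c * z - \<omega>) + 1 / \<omega> + c * z / \<omega>\<^sup>2) ((*) c ` (L - {0})) =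
     infsum (\<lambda>\<omega>. (1 / c) * (1 / (z - \<omega>) + 1 / \<omega> + z / \<omega>\<^sup>2)) (L - {0})"
  proof (subst infsum_reindex)
    show "inj_on ((*) c) (L - {0})" using assms by (auto simp: inj_on_def)
    have "1 / (c * z - c * \<omega>) + 1 / (c * \<omega>) + c * z / (c * \<omega>)\<^sup>2 =
       (1 / c) * (1 / (z - \<omega>) + 1 / \<omega> + z / \<omega>\<^sup>2)" for \<omega>
    proof -
      have "c * z - c * \<omega> = c * (z - \<omega>)" by (simp add: algebra_simps)
      moreover have "c * z / (c * \<omega>)\<^sup>2 = z / \<omega>\<^sup>2 / c" using assms by (simp add: power2_eq_square)
      ultimately show ?thesis by (simp add: ring_distribs)
    qed
    thus "infsum ((\<lambda>\<omega>. 1 / (c * z - \<omega>) + 1 / \<omega> + c * z / \<omega>\<^sup>2) \<circ> (*) c) (L - {0}) =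
      infsum (\<lambda>\<omega>. (1 / c) * (1 / (z - \<omega>) + 1 / \<omega> + z / \<omega>\<^sup>2)) (L - {0})"
      by (simp add: o_def)
  qed
  ultimately show ?thesis
    unfolding weierstrass_zeta_def by (simp only: infsum_cmult_right') (simp add: add_divide_distrib)
qed

text \<open>The zeta function has degree \<open>-1\<close> in argument and lattice jointly, so the
  right-hand side satisfies the defining equation of the quasi-period of the unscaled lattice;
  uniqueness finishes.\<close>

lemma weierstrass_eta_scale:
  assumes "Im \<tau> > 0" "Im \<tau>' > 0" "j \<noteq> 0" "period_lattice \<tau> 1 = (*) j ` period_lattice \<tau>' 1"
  shows "weierstrass_eta w (period_lattice \<tau>' 1) = j * weierstrass_eta (j * w) (period_lattice \<tau> 1)"
proof -
  let ?L = "period_lattice \<tau> 1" and ?L' = "period_lattice \<tau>' 1"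
  obtain \<alpha> where \<alpha>: "\<And>w. weierstrass_eta w ?L = \<alpha> * w - 2 * of_real pi * \<i> * of_real (Im w / Im \<tau>)"
    "\<And>\<omega> z. \<omega> \<in> ?L \<Longrightarrow> z \<notin> ?L \<Longrightarrow>
      weierstrass_zeta (z + \<omega>) ?L = weierstrass_zeta z ?L + weierstrass_eta \<omega> ?L"
    using weierstrass_eta_formula[OF assms(1)] by blast
  show ?thesis
  proof (rule weierstrass_eta_eqI[OF assms(2), where h = "\<lambda>w. j * weierstrass_eta (j * w) ?L"])
    show "linear (\<lambda>w. j * weierstrass_eta (j * w) ?L)"
      by (rule linearI) (simp_all add: \<alpha>(1) algebra_simps add_divide_distrib diff_divide_distrib scaleR_conv_of_real)
    fix \<omega> z assume "\<omega> \<in> ?L'" "z \<notin> ?L'"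
    hence "j * \<omega> \<in> ?L" "j * z \<notin> ?L" using assms(3,4) by auto
    hence "weierstrass_zeta (j * (z + \<omega>)) ?L = weierstrass_zeta (j * z) ?L + weierstrass_eta (j * \<omega>) ?L"
      using \<alpha>(2)[of "j * \<omega>" "j * z"] by (simp add: ring_distribs)
    thus "weierstrass_zeta (z + \<omega>) ?L' = weierstrass_zeta z ?L' + j * weierstrass_eta (j * \<omega>) ?L"
      unfolding assms(4) weierstrass_zeta_scale[OF assms(3)] using assms(3) by (simp add: field_simps)
  qed
qed

section \<open>Compatibility of the two actions\<close>

lemma aut_factor_nonzero:
  assumes "det M = 1" "Im \<tau> > 0"
  shows "aut_factor M \<tau> \<noteq> 0"
proof
  assume *: "aut_factor M \<tau> = 0"
  hence "Im (aut_factor M \<tau>) = 0" by simp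
  hence "M $ 2 $ 1 = 0" using assms by (simp add: aut_factor_def)
  moreover from this have "M $ 2 $ 2 = 0" using * by (simp add: aut_factor_def)
  ultimately show False using assms(1) by (simp add: det_2)
qed

lemma Im_moebius_act_pos:
  assumes "det M = 1" "Im \<tau> > 0"
  shows "Im (moebius_act M \<tau>) > 0"
proof -
  let ?j = "aut_factor M \<tau>"
  have d: "real_of_int (M $ 1 $ 1) * real_of_int (M $ 2 $ 2) - real_of_int (M $ 1 $ 2) * real_of_int (M $ 2 $ 1) = 1"
    using assms(1) unfolding det_2 by (metis of_int_1 of_int_diff of_int_mult)
  have "Im (of_int (M $ 1 $ 1) * \<tau> + of_int (M $ 1 $ 2)) * Re ?j
      - Re (of_int (M $ 1 $ 1) * \<tau> + of_int (M $ 1 $ 2)) * Im ?j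
      = (real_of_int (M $ 1 $ 1) * real_of_int (M $ 2 $ 2) - real_of_int (M $ 1 $ 2) * real_of_int (M $ 2 $ 1)) * Im \<tau>"
    by (simp add: aut_factor_def algebra_simps)
  hence "Im (moebius_act M \<tau>) = Im \<tau> / ((Re ?j)\<^sup>2 + (Im ?j)\<^sup>2)"
    unfolding moebius_act_def d by (simp add: Im_divide)
  moreover have "(Re ?j)\<^sup>2 + (Im ?j)\<^sup>2 > 0"
    using aut_factor_nonzero[OF assms] by (simp add: complex_eq_iff sum_power2_gt_zero_iff)
  ultimately show ?thesis using assms(2) by simp
qed

text \<open>Multiplication by \<open>c * \<tau> + d\<close> turns the basis of the second lattice
  into \<open>a * \<tau> + b\<close> and \<open>c * \<tau> + d\<close>, a unimodular change of the
  basis \<open>\<tau>\<close>, \<open>1\<close>.\<close>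

lemma period_lattice_moebius_act:
  assumes "det M = 1" "Im \<tau> > 0"
  shows "period_lattice \<tau> 1 = (*) (aut_factor M \<tau>) ` period_lattice (moebius_act M \<tau>) 1"
proof -
  let ?j = "aut_factor M \<tau>"
  let ?a = "M $ 1 $ 1" and ?b = "M $ 1 $ 2" and ?c = "M $ 2 $ 1" and ?d = "M $ 2 $ 2"
  have det: "?a * ?d - ?b * ?c = 1" using assms(1) by (simp add: det_2)
  have eq: "?j * (of_int m * moebius_act M \<tau> + of_int n) = of_int (m * ?a + n * ?c) * \<tau> + of_int (m * ?b + n * ?d)" for m n
  proof -
    have "?j * moebius_act M \<tau> = of_int ?a * \<tau> + of_int ?b"
      using aut_factor_nonzero[OF assms] by (simp add: moebius_act_def)
    thus ?thesis by (simp add: ring_distribs mult.left_commute[of ?j]) (simp add: aut_factor_def algebra_simps)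
  qed
  show ?thesis
  proof (intro equalityI subsetI)
    fix z assume "z \<in> period_lattice \<tau> 1"
    then obtain p q where z: "z = of_int p * \<tau> + of_int q" by (auto simp: period_lattice_def)
    \<comment> \<open>The row vector \<open>(p, q)\<close> times the inverse of
      \<open>M\<close>.\<close>
    define m n where "m = p * ?d - q * ?c" and "n = q * ?a - p * ?b"
    have "m * ?a + n * ?c = p * (?a * ?d - ?b * ?c)" "m * ?b + n * ?d = q * (?a * ?d - ?b * ?c)"
      by (simp_all add: m_def n_def algebra_simps)
    hence "z = ?j * (of_int m * moebius_act M \<tau> + of_int n)" unfolding eq z det by simp
    moreover have "of_int m * moebius_act M \<tau> + of_int n \<in> period_lattice (moebius_act M \<tau>) 1"
      unfolding period_lattice_def by force
    ultimately show "z \<in> (*) ?j ` period_lattice (moebius_act M \<tau>) 1" by blast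
  next
    fix z assume "z \<in> (*) ?j ` period_lattice (moebius_act M \<tau>) 1"
    then obtain m n where "z = ?j * (of_int m * moebius_act M \<tau> + of_int n)"
      by (auto simp: period_lattice_def)
    hence "z = of_int (m * ?a + n * ?c) * \<tau> + of_int (m * ?b + n * ?d) * 1" unfolding eq mult_1_right .
    thus "z \<in> period_lattice \<tau> 1" unfolding period_lattice_def by blast
  qed
qed

lemma \<psi>_scale:
  assumes "j \<noteq> 0"
  shows "\<psi> (j * x) ((*) j ` L) = \<psi> x L"
proof -
  have "j * x \<in> (*) j ` L \<longleftrightarrow> x \<in> L" using assms by auto
  moreover have "j * x \<in> (\<lambda>\<omega>. 2 * \<omega>) ` (*) j ` L \<longleftrightarrow> x \<in> (\<lambda>\<omega>. 2 * \<omega>) ` L"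
    using assms by (auto simp: image_iff mult.left_commute[of 2])
  ultimately show ?thesis by (simp add: \<psi>_def)
qed

text \<open>In real coordinates the sign is independent of \<open>\<tau>\<close>, hence constant
  along a torsion section.\<close>

lemma \<psi>_coords:
  assumes "Im \<tau> > 0"
  shows "\<psi> (of_real a * \<tau> + of_real b) (period_lattice \<tau> 1) =
    (if a \<in> \<int> \<and> b \<in> \<int> \<and> \<not> (a / 2 \<in> \<int> \<and> b / 2 \<in> \<int>) then - 1 else 1)"
proof -
  let ?x = "of_real a * \<tau> + of_real b"
  have "?x \<in> (\<lambda>\<omega>. 2 * \<omega>) ` period_lattice \<tau> 1 \<longleftrightarrow> ?x / 2 \<in> period_lattice \<tau> 1"
    by (auto simp: image_iff intro!: bexI[of _ "?x / 2"])
  also have "?x / 2 = of_real (a / 2) * \<tau> + of_real (b / 2)" by (simp add: add_divide_distrib)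
  finally have "?x \<in> (\<lambda>\<omega>. 2 * \<omega>) ` period_lattice \<tau> 1 \<longleftrightarrow> a / 2 \<in> \<int> \<and> b / 2 \<in> \<int>"
    unfolding period_lattice_iff[OF assms] .
  thus ?thesis unfolding \<psi>_def by (simp add: period_lattice_iff[OF assms])
qed

text \<open>Both the sign and the product of \<open>\<eta>(x)\<close> with \<open>x / 2\<close> are
  unchanged when point and lattice are scaled together. Scaling by
  \<open>aut_factor M \<tau>\<close> therefore replaces the row vector \<open>X\<close> by
  \<open>X\<close> times \<open>M\<close>, whose point is \<open>y\<close>, and leaves the rest to
  the matrix action.\<close>

lemma slash_slash_vec:
  fixes X :: "real ^ 2" and M :: "int ^ 2 ^ 2"
  assumes "det M = 1" "Im \<tau> > 0"
  defines "y \<equiv> of_real (X $ 1 * of_int (M $ 1 $ 1) + X $ 2 * of_int (M $ 2 $ 1)) * \<tau>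
     + of_real (X $ 1 * of_int (M $ 1 $ 2) + X $ 2 * of_int (M $ 2 $ 2))"
  shows "slash k (\<lambda>\<tau>. slash_vec k \<phi> X \<tau> 0) M \<tau> =
    (\<psi> y (period_lattice \<tau> 1) * exp (weierstrass_eta y (period_lattice \<tau> 1) * (y / 2))) powi k * slash_mat k \<phi> M \<tau> y"
proof -
  define j where "j = aut_factor M \<tau>"
  define t where "t = moebius_act M \<tau>"
  define x where "x = of_real (X $ 1) * t + of_real (X $ 2)"
  have j: "j \<noteq> 0" using aut_factor_nonzero[OF assms(1,2)] by (simp add: j_def)
  have L: "period_lattice \<tau> 1 = (*) j ` period_lattice t 1"
    unfolding j_def t_def by (rule period_lattice_moebius_act[OF assms(1,2)])
  have jt: "j * t = of_int (M $ 1 $ 1) * \<tau> + of_int (M $ 1 $ 2)"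
    using j by (simp add: t_def moebius_act_def j_def)
  have "j * x = of_real (X $ 1) * (j * t) + of_real (X $ 2) * j" by (simp add: x_def algebra_simps)
  also have "\<dots> = y" unfolding jt by (simp add: y_def j_def aut_factor_def algebra_simps)
  finally have y: "y = j * x" ..
  have "weierstrass_eta x (period_lattice t 1) = j * weierstrass_eta y (period_lattice \<tau> 1)"
    unfolding y using Im_moebius_act_pos[OF assms(1,2)]
    by (intro weierstrass_eta_scale[OF assms(2) _ j L]) (simp add: t_def)
  hence "weierstrass_eta x (period_lattice t 1) * (x / 2) = weierstrass_eta y (period_lattice \<tau> 1) * (y / 2)"
    by (simp add: y)
  moreover have "\<psi> y (period_lattice \<tau> 1) = \<psi> x (period_lattice t 1)" unfolding L y by (rule \<psi>_scale[OF j])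
  ultimately have "slash_vec k \<phi> X t 0 =
     (\<psi> y (period_lattice \<tau> 1) * exp (weierstrass_eta y (period_lattice \<tau> 1) * (y / 2))) powi k * \<phi> t x"
    by (simp add: slash_vec_def x_def Let_def)
  moreover have "y / j = x" using j by (simp add: y)
  ultimately show ?thesis unfolding slash_def slash_mat_def j_def[symmetric] t_def[symmetric] by simp
qed

text \<open>The constant of the general formula is \<open>\<eta>(1)\<close>, since the Legendre term
  vanishes at \<open>1\<close>.\<close>

lemma weierstrass_eta_coords:
  assumes "Im \<tau> > 0"
  shows "weierstrass_eta (of_real a * \<tau> + of_real b) (period_lattice \<tau> 1) =
    weierstrass_eta 1 (period_lattice \<tau> 1) * (of_real a * \<tau> + of_real b) - 2 * of_real pi * \<i> * of_real a"
proof -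
  obtain \<alpha> where \<alpha>: "\<And>w. weierstrass_eta w (period_lattice \<tau> 1) = \<alpha> * w - 2 * of_real pi * \<i> * of_real (Im w / Im \<tau>)"
    by (rule weierstrass_eta_formula[OF assms]) (rule that, assumption)
  have "Im (of_real a * \<tau> + of_real b) / Im \<tau> = a" using assms by simp
  thus ?thesis unfolding \<alpha> by simp
qed

text \<open>By Legendre's relation the exponential factors compose up to
  \<open>exp (pi * \<i> * D)\<close>, where \<open>D\<close> is the determinant of \<open>X\<close>
  and \<open>Y\<close>; an even \<open>D\<close> makes this \<open>1\<close>. Evenness of
  \<open>Y\<close> takes care of the signs.\<close>

lemma slash_vec_even_shift:
  fixes X Y :: "real ^ 2"
  assumes "Im \<tau> > 0"
    and Y: "Y $ 1 / 2 \<in> \<int>" "Y $ 2 / 2 \<in> \<int>" "(X $ 1 * Y $ 2 - Y $ 1 * X $ 2) / 2 \<in> \<int>"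
    and \<phi>: "\<And>z. slash_vec k \<phi> Y \<tau> z = \<phi> \<tau> z"
  shows "slash_vec k \<phi> (X + Y) \<tau> 0 = slash_vec k \<phi> X \<tau> 0"
proof -
  let ?L = "period_lattice \<tau> 1"
  define x where "x = of_real (X $ 1) * \<tau> + of_real (X $ 2)"
  define y where "y = of_real (Y $ 1) * \<tau> + of_real (Y $ 2)"
  define \<eta> where "\<eta> = (\<lambda>w. weierstrass_eta w ?L)"
  have xy: "of_real ((X + Y) $ 1) * \<tau> + of_real ((X + Y) $ 2) = x + y"
    by (simp add: x_def y_def algebra_simps)
  obtain m n :: int where mn: "Y $ 1 / 2 = of_int m" "Y $ 2 / 2 = of_int n" using Y by (auto elim!: Ints_cases)
  have Y': "Y $ 1 = of_int (2 * m)" "Y $ 2 = of_int (2 * n)" using mn by simp_all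
  have shift: "a + of_int p \<in> \<int> \<longleftrightarrow> a \<in> \<int>" for a :: real and p
    by (metis Ints_add Ints_diff Ints_of_int add_diff_cancel_right')
  have shift2: "(a + of_int (2 * p)) / 2 \<in> \<int> \<longleftrightarrow> a / 2 \<in> \<int>" for a :: real and p
    using shift[of "a / 2" p] by (simp add: add_divide_distrib)
  have \<psi>xy: "\<psi> (x + y) ?L = \<psi> x ?L"
    unfolding xy[symmetric] unfolding x_def \<psi>_coords[OF assms(1)] vector_add_component Y' shift shift2 ..
  have \<psi>y: "\<psi> y ?L = 1" unfolding y_def \<psi>_coords[OF assms(1)] using Y by simp
  have \<eta>: "\<eta> (x + y) = \<eta> 1 * (x + y) - 2 * of_real pi * \<i> * of_real (X $ 1 + Y $ 1)"
    "\<eta> x = \<eta> 1 * x - 2 * of_real pi * \<i> * of_real (X $ 1)"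
    "\<eta> y = \<eta> 1 * y - 2 * of_real pi * \<i> * of_real (Y $ 1)"
    unfolding xy[symmetric] unfolding x_def y_def \<eta>_def weierstrass_eta_coords[OF assms(1)]
    by simp_all
  obtain l :: int where l: "(X $ 1 * Y $ 2 - Y $ 1 * X $ 2) / 2 = of_int l" using Y by (auto elim!: Ints_cases)
  \<comment> \<open>The multiples of \<open>\<tau>\<close> cancel, leaving the determinant.\<close>
  have "of_real (X $ 1) * y - of_real (Y $ 1) * x = of_real (X $ 1 * Y $ 2 - Y $ 1 * X $ 2)"
    by (simp add: x_def y_def algebra_simps)
  also have "X $ 1 * Y $ 2 - Y $ 1 * X $ 2 = 2 * of_int l" using l by simp
  finally have leg: "of_real (X $ 1) * y - of_real (Y $ 1) * x = 2 * of_int l" by simp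
  have "\<eta> x * (x / 2) + \<eta> y * (x + y / 2) - \<eta> (x + y) * ((x + y) / 2) =
    of_real pi * \<i> * (of_real (X $ 1) * y - of_real (Y $ 1) * x)"
    unfolding \<eta> by (simp add: field_simps)
  also have "\<dots> = 2 * of_int l * of_real pi * \<i>" unfolding leg by simp
  finally have ex: "\<eta> x * (x / 2) + \<eta> y * (x + y / 2) = \<eta> (x + y) * ((x + y) / 2) + 2 * of_int l * of_real pi * \<i>"
    by (simp add: algebra_simps)
  have e1: "exp (2 * of_int l * of_real pi * \<i>) = 1"
    by (subst exp_eq_1) auto
  have e: "exp (\<eta> x * (x / 2)) * exp (\<eta> y * (x + y / 2)) = exp (\<eta> (x + y) * ((x + y) / 2))"
    unfolding exp_add[symmetric] ex unfolding exp_add e1 by simp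
  have "\<phi> \<tau> x = exp (\<eta> y * (x + y / 2)) powi k * \<phi> \<tau> (x + y)"
    using \<phi>[of x] \<psi>y by (simp add: slash_vec_def Let_def y_def \<eta>_def)
  hence "slash_vec k \<phi> X \<tau> 0 = (\<psi> x ?L * (exp (\<eta> x * (x / 2)) * exp (\<eta> y * (x + y / 2)))) powi k * \<phi> \<tau> (x + y)"
    by (simp add: slash_vec_def Let_def power_int_mult_distrib \<eta>_def flip: x_def)
  also have "\<dots> = slash_vec k \<phi> (X + Y) \<tau> 0"
    unfolding e unfolding slash_vec_def Let_def xy \<psi>xy \<eta>_def by simp
  finally show ?thesis ..
qed

section \<open>Series in \<open>q\<close> and \<open>\<zeta>\<close> with few powers of \<open>\<zeta>\<close>\<close>

lemma poly_coeff_Cauchy_bound: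
  fixes p :: "complex poly"
  assumes "r > 0" "\<And>z. norm z = r \<Longrightarrow> norm (poly p z) \<le> B"
  shows "norm (coeff p n) * r ^ n \<le> B"
proof -
  have deriv: "(deriv ^^ n) (poly p) = poly ((pderiv ^^ n) p)" for n
  proof (induction n)
    case (Suc n)
    show ?case by (auto simp: Suc intro!: ext DERIV_imp_deriv poly_DERIV)
  qed simp
  have "norm ((deriv ^^ n) (poly p) 0) \<le> fact n * B / r ^ n"
    using assms by (intro Cauchy_inequality) (auto intro!: holomorphic_intros continuous_intros)
  also have "(deriv ^^ n) (poly p) 0 = fact n * coeff p n"
    by (simp add: deriv poly_0_coeff_0 coeff_higher_pderiv flip: pochhammer_fact)
  finally show ?thesis using assms(1) by (simp add: norm_mult field_simps)
qed

text \<open>Cauchy's estimate bounds the Taylor coefficients at \<open>a\<close>; summing that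
  expansion bounds \<open>p\<close> on the unit circle, where Cauchy's estimate applies once more. A
  bound on a small circle anywhere thus controls all coefficients, at a cost exponential only in the
  degree.\<close>

lemma poly_coeff_bound_from_circle:
  fixes p :: "complex poly"
  assumes deg: "degree p \<le> d" and \<delta>: "0 < \<delta>" "\<delta> \<le> 1"
    and bound: "\<And>z. norm (z - a) = \<delta> \<Longrightarrow> norm (poly p z) \<le> B"
  shows "norm (coeff p i) \<le> B * real (Suc d) * ((1 + norm a) / \<delta>) ^ d"
proof -
  define q where "q = pcompose p [:a, 1:]"
  have B: "B \<ge> 0" using bound[of "a + of_real \<delta>"] \<delta> by (auto intro: order_trans[OF norm_ge_zero])
  have q: "norm (coeff q j) * \<delta> ^ j \<le> B" for j
  proof (rule poly_coeff_Cauchy_bound[OF \<delta>(1)])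
    fix z :: complex assume "norm z = \<delta>"
    thus "norm (poly q z) \<le> B" using bound[of "a + z"] by (simp add: q_def poly_pcompose)
  qed
  have dq: "degree q \<le> d" using deg by (simp add: q_def degree_pcompose)
  have ge1: "1 \<le> (1 + norm a) / \<delta>" using \<delta> by (simp add: pos_le_divide_eq add_increasing2)
  have "norm (coeff p i) * 1 ^ i \<le> B * real (Suc d) * ((1 + norm a) / \<delta>) ^ d"
  proof (rule poly_coeff_Cauchy_bound)
    fix z :: complex assume z: "norm z = 1"
    have "poly p z = poly q (z - a)" by (simp add: q_def poly_pcompose)
    also have "\<dots> = (\<Sum>j\<le>d. coeff q j * (z - a) ^ j)"
      unfolding poly_altdef using dq
      by (intro sum.mono_neutral_left) (auto simp: coeff_eq_0)
    also have "norm \<dots> \<le> (\<Sum>j\<le>d. B * ((1 + norm a) / \<delta>) ^ d)"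
    proof (rule sum_norm_le)
      fix j assume j: "j \<in> {..d}"
      have "norm (coeff q j * (z - a) ^ j) \<le> (B / \<delta> ^ j) * (1 + norm a) ^ j"
        unfolding norm_mult norm_power
        using q[of j] \<delta> B z norm_triangle_ineq4[of z a]
        by (intro mult_mono power_mono) (auto simp: field_simps)
      also have "\<dots> = B * ((1 + norm a) / \<delta>) ^ j" by (simp add: power_divide)
      also have "\<dots> \<le> B * ((1 + norm a) / \<delta>) ^ d"
        using j B ge1 by (intro mult_left_mono power_increasing) auto
      finally show "norm (coeff q j * (z - a) ^ j) \<le> B * ((1 + norm a) / \<delta>) ^ d" .
    qed
    also have "\<dots> = B * real (Suc d) * ((1 + norm a) / \<delta>) ^ d" by simp
    finally show "norm (poly p z) \<le> B * real (Suc d) * ((1 + norm a) / \<delta>) ^ d" .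
  qed simp
  thus ?thesis by simp
qed

text \<open>Since \<open>f n\<close> is \<open>o(n)\<close>, eventually
  \<open>f n * ln G \<le> n * ln t\<close>; the finitely many earlier values go into
  \<open>K\<close>.\<close>

lemma power_sublinear_bound:
  fixes G t :: real and f :: "nat \<Rightarrow> nat"
  assumes "(\<lambda>n. real (f n) / real n) \<longlonglongrightarrow> 0" "G \<ge> 1" "t > 1"
  obtains K where "K > 0" "\<And>n. G ^ f n \<le> K * t ^ n"
proof -
  \<comment> \<open>The \<open>1\<close> keeps the denominator positive when
    \<open>G = 1\<close>.\<close>
  define \<epsilon> where "\<epsilon> = ln t / (ln G + 1)"
  have G: "ln G \<ge> 0" using assms by simp
  have "\<epsilon> > 0" unfolding \<epsilon>_def using assms(3) by (intro divide_pos_pos add_nonneg_pos[OF G]) auto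
  hence "\<forall>\<^sub>F n in sequentially. real (f n) / real n < \<epsilon>"
    using assms(1) by (rule order_tendstoD(2)[rotated])
  then obtain N where N: "\<And>n. n \<ge> N \<Longrightarrow> real (f n) / real n < \<epsilon>"
    by (auto simp: eventually_sequentially)
  define K where "K = 1 + (\<Sum>n\<le>N. G ^ f n)"
  have Gp: "G ^ m \<ge> 0" for m using assms by simp
  have "K \<ge> 1" unfolding K_def using Gp by (simp add: sum_nonneg)
  have "G ^ f n \<le> K * t ^ n" for n
  proof (cases "n \<le> N")
    case True
    have "G ^ f n \<le> (\<Sum>n\<le>N. G ^ f n)" using True Gp by (intro member_le_sum) auto
    also have "\<dots> \<le> K * 1" by (simp add: K_def)
    also have "\<dots> \<le> K * t ^ n" using \<open>K \<ge> 1\<close> assms by (intro mult_left_mono one_le_power) auto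
    finally show ?thesis .
  next
    case False
    hence "n > 0" "n \<ge> N" by auto
    hence "real (f n) \<le> \<epsilon> * real n" using N[of n] by (simp add: field_simps)
    hence "real (f n) * ln G \<le> \<epsilon> * real n * ln G" using G by (rule mult_right_mono)
    also have "\<dots> \<le> \<epsilon> * real n * (ln G + 1)" using \<open>\<epsilon> > 0\<close> by (intro mult_left_mono) auto
    also have "\<dots> = real n * ln t" using G by (simp add: \<epsilon>_def)
    finally have "ln (G ^ f n) \<le> ln (t ^ n)" using assms by (simp add: ln_realpow)
    hence "G ^ f n \<le> t ^ n" using assms by (subst (asm) ln_le_cancel_iff) auto
    also have "\<dots> \<le> K * t ^ n" using \<open>K \<ge> 1\<close> assms by simp
    finally show ?thesis .
  qed
  with \<open>K \<ge> 1\<close> show ?thesis by (intro that[of K]) auto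
qed

text \<open>Absorbs the number of exponents \<open>r\<close> with absolute value at most
  \<open>m\<close> into an exponential.\<close>

lemma bernoulli_pow3: "real (2 * m + 1) \<le> 3 ^ m"
  by (induction m) auto

text \<open>Baire's theorem makes the pointwise bounds uniform on some disc. Passing from the disc
  to the coefficients costs a factor exponential in \<open>r0 n\<close>, which is
  \<open>o(n)\<close> and so is paid for by lowering \<open>q\<close> to \<open>q'\<close>.\<close>

lemma laurent_coeff_subexponential_bound:
  fixes c :: "nat \<Rightarrow> int \<Rightarrow> complex" and r0 :: "nat \<Rightarrow> nat"
  assumes r0: "(\<lambda>n. real (r0 n) / real n) \<longlonglongrightarrow> 0"
    and q: "0 < q'" "q' < q"
    and bounded: "\<And>\<zeta>. \<zeta> \<noteq> 0 \<Longrightarrow> Bseq (\<lambda>n. \<Sum>r | \<bar>r\<bar> \<le> int (r0 n). c n r * of_real q ^ n * \<zeta> powi r)"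
  obtains K where "K > 0" "\<And>n r. \<bar>r\<bar> \<le> int (r0 n) \<Longrightarrow> norm (c n r) * q' ^ n \<le> K"
proof -
  have fin: "finite {r. \<bar>r\<bar> \<le> int m}" for m
    by (rule finite_subset[of _ "{-int m..int m}"]) auto
  \<comment> \<open>The Laurent polynomial in \<open>\<zeta>\<close> multiplied by
    \<open>\<zeta> ^ r0 n\<close>, with the power of \<open>q\<close> left out.\<close>
  define P where "P = (\<lambda>n. \<Sum>r | \<bar>r\<bar> \<le> int (r0 n). monom (c n r) (nat (r + int (r0 n))))"
  have poly_P: "poly (P n) \<zeta> * of_real q ^ n = \<zeta> ^ r0 n * (\<Sum>r | \<bar>r\<bar> \<le> int (r0 n). c n r * of_real q ^ n * \<zeta> powi r)"
    if "\<zeta> \<noteq> 0" for n \<zeta>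
    unfolding P_def poly_sum sum_distrib_left sum_distrib_right poly_monom
  proof (intro sum.cong refl)
    fix r assume "r \<in> {r. \<bar>r\<bar> \<le> int (r0 n)}"
    hence "\<zeta> ^ nat (r + int (r0 n)) = \<zeta> powi (r + int (r0 n))" by (simp add: power_int_def)
    also have "\<dots> = \<zeta> powi r * \<zeta> ^ r0 n" using that by (simp add: power_int_add)
    finally show "c n r * \<zeta> ^ nat (r + int (r0 n)) * complex_of_real q ^ n =
         \<zeta> ^ r0 n * (c n r * complex_of_real q ^ n * \<zeta> powi r)" by simp
  qed
  have coeff_P: "coeff (P n) (nat (r + int (r0 n))) = c n r" if "\<bar>r\<bar> \<le> int (r0 n)" for n r
  proof -
    have "coeff (P n) (nat (r + int (r0 n))) = (\<Sum>s | \<bar>s\<bar> \<le> int (r0 n). if s = r then c n s else 0)"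
      unfolding P_def coeff_sum using that by (intro sum.cong refl) auto
    also have "\<dots> = c n r" using that fin by (subst sum.delta) auto
    finally show ?thesis .
  qed
  have deg_P: "degree (P n) \<le> 2 * r0 n" for n
    unfolding P_def by (intro degree_sum_le fin order_trans[OF degree_monom_le]) auto
  \<comment> \<open>The bound \<open>K\<close> on all terms, cleared of negative powers of
    \<open>\<zeta>\<close>, so that the set is closed in the whole plane.\<close>
  define E where "E = (\<lambda>K. {\<zeta>. \<forall>n. norm (poly (P n) \<zeta>) * q ^ n \<le> K * norm \<zeta> ^ r0 n})"
  have "closed (E K)" for K
    unfolding E_def by (intro closed_Collect_all closed_Collect_le continuous_intros)
  have cover: "\<exists>k::nat. \<zeta> \<in> E (real k)" if "\<zeta> \<noteq> 0" for \<zeta>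
  proof -
    from bounded[OF that] obtain K where K: "K > 0"
      "\<And>n. norm (\<Sum>r | \<bar>r\<bar> \<le> int (r0 n). c n r * of_real q ^ n * \<zeta> powi r) \<le> K"
      by (auto simp: Bseq_def)
    obtain k :: nat where k: "K \<le> real k" using real_arch_simple by blast
    have "norm (poly (P n) \<zeta>) * q ^ n \<le> real k * norm \<zeta> ^ r0 n" for n
    proof -
      have "norm (poly (P n) \<zeta>) * q ^ n = norm (poly (P n) \<zeta> * of_real q ^ n)"
        using q by (simp add: norm_mult norm_power)
      also have "\<dots> \<le> norm \<zeta> ^ r0 n * real k"
        unfolding poly_P[OF that] norm_mult norm_power
        by (intro mult_left_mono order_trans[OF K(2) k]) auto
      finally show ?thesis by (simp add: mult.commute)
    qed
    thus ?thesis by (auto simp: E_def)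
  qed
  \<comment> \<open>Countably many closed sets cover the punctured plane, so one of them has
    interior points.\<close>
  have "\<exists>k::nat. interior (E (real k)) \<noteq> {}"
  proof (rule ccontr)
    assume "\<not> ?thesis"
    hence int_empty: "interior (E (real k)) = {}" for k by blast
    \<comment> \<open>\<open>0\<close> lies in no \<open>E k\<close> in general, but its complement is open and dense.\<close>
    define \<G> where "\<G> = insert (- {0}) ((\<lambda>k::nat. - E (real k)) ` UNIV)"
    have "UNIV \<subseteq> closure (\<Inter>\<G>)"
    proof (rule Baire)
      fix T assume "T \<in> \<G>"
      thus "openin (top_of_set UNIV) T \<and> UNIV \<subseteq> closure T"
        using \<open>\<And>K. closed (E K)\<close> int_empty
        by (auto simp: \<G>_def open_Compl closure_complement)
    qed (auto simp: \<G>_def)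
    moreover have "\<Inter>\<G> = {}" using cover by (auto simp: \<G>_def)
    ultimately show False by simp
  qed
  then obtain k :: nat and a where "a \<in> interior (E (real k))" by blast
  then obtain \<delta>0 where \<delta>0: "\<delta>0 > 0" "ball a \<delta>0 \<subseteq> E (real k)" by (meson mem_interior)
  define \<delta> where "\<delta> = min 1 (\<delta>0 / 2)"
  have \<delta>: "0 < \<delta>" "\<delta> \<le> 1" "\<delta> < \<delta>0" using \<delta>0 by (auto simp: \<delta>_def)
  define A where "A = 1 + norm a"
  have A: "A \<ge> 1" by (simp add: A_def)
  \<comment> \<open>Per unit of \<open>r0 n\<close>: \<open>A\<close> bounds \<open>norm z\<close>,
    the square comes from the degree \<open>2 * r0 n\<close>, and \<open>3\<close> from the count of
    coefficients.\<close>
  define G where "G = A * ((A / \<delta>)\<^sup>2 * 3)"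
  have "A / \<delta> \<ge> 1" using A \<delta> by (simp add: pos_le_divide_eq)
  hence "1 * (1 * 1) \<le> G" unfolding G_def using A by (intro mult_mono one_le_power) auto
  hence G: "G \<ge> 1" by simp
  have coeff: "norm (c n r) * q ^ n \<le> real k * G ^ r0 n" if r: "\<bar>r\<bar> \<le> int (r0 n)" for n r
  proof -
    have "norm (coeff (P n) (nat (r + int (r0 n)))) \<le>
       (real k * A ^ r0 n / q ^ n) * real (Suc (2 * r0 n)) * ((1 + norm a) / \<delta>) ^ (2 * r0 n)"
    proof (rule poly_coeff_bound_from_circle[OF deg_P \<delta>(1,2)])
      fix z assume z: "norm (z - a) = \<delta>"
      hence "z \<in> E (real k)" using \<delta>0(2) \<delta> by (auto simp: dist_norm norm_minus_commute)
      hence "norm (poly (P n) z) * q ^ n \<le> real k * norm z ^ r0 n" by (simp add: E_def)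
      also have "\<dots> \<le> real k * A ^ r0 n"
        using z \<delta> norm_triangle_sub[of z a] by (intro mult_left_mono power_mono) (auto simp: A_def)
      finally show "norm (poly (P n) z) \<le> real k * A ^ r0 n / q ^ n" using q by (simp add: pos_le_divide_eq)
    qed
    also have "\<dots> = real k * A ^ r0 n * (real (2 * r0 n + 1) * (A / \<delta>) ^ (2 * r0 n)) / q ^ n"
      by (simp add: A_def)
    finally have "norm (c n r) * q ^ n \<le> real k * A ^ r0 n * (real (2 * r0 n + 1) * (A / \<delta>) ^ (2 * r0 n))"
      using q unfolding coeff_P[OF r] by (subst (asm) pos_le_divide_eq) auto
    also have "\<dots> \<le> real k * A ^ r0 n * (3 ^ r0 n * (A / \<delta>) ^ (2 * r0 n))"
      using A \<delta> by (intro mult_left_mono mult_right_mono bernoulli_pow3) auto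
    also have "\<dots> = real k * G ^ r0 n" by (simp add: G_def power_mult_distrib power_mult)
    finally show ?thesis .
  qed
  obtain K where K: "K > 0" "\<And>n. G ^ r0 n \<le> K * (q / q') ^ n"
    using power_sublinear_bound[OF r0 G, of "q / q'"] q by (auto simp: pos_less_divide_eq)
  show ?thesis
  \<comment> \<open>The \<open>1\<close> ensures positivity even for \<open>k = 0\<close>.\<close>
  proof (rule that[of "real k * K + 1"])
    show "0 < real k * K + 1" using K by (intro add_nonneg_pos mult_nonneg_nonneg) auto
    fix n r assume r: "\<bar>r\<bar> \<le> int (r0 n)"
    have "norm (c n r) * q ^ n \<le> real k * (K * (q / q') ^ n)"
      using coeff[OF r] K(2)[of n] by (meson mult_left_mono of_nat_0_le_iff order_trans)
    hence "norm (c n r) * q' ^ n \<le> real k * K" using q by (simp add: power_divide field_simps)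
    thus "norm (c n r) * q' ^ n \<le> real k * K + 1" by simp
  qed
qed

text \<open>The substitution produces exponents \<open>d * n + b * r\<close> of \<open>W\<close>. As
  \<open>r0 n\<close> is \<open>o(n)\<close>, they are nonnegative from some \<open>n\<close> on,
  and the coefficient bound makes that tail converge locally uniformly in the unit disc.\<close>

lemma q_zeta_series_meromorphic:
  fixes c :: "nat \<Rightarrow> int \<Rightarrow> complex" and r0 :: "nat \<Rightarrow> nat" and \<kappa> :: complex and b :: int and d :: nat
  assumes r0: "(\<lambda>n. real (r0 n) / real n) \<longlonglongrightarrow> 0"
    and conv: "\<And>q \<zeta>. 0 < q \<Longrightarrow> q < 1 \<Longrightarrow> \<zeta> \<noteq> 0 \<Longrightarrow>
       summable (\<lambda>n. \<Sum>r | \<bar>r\<bar> \<le> int (r0 n). c n r * of_real q ^ n * \<zeta> powi r)"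
    and "\<kappa> \<noteq> 0" "d > 0"
  obtains g where "g meromorphic_on {0}" "g holomorphic_on ball 0 1 - {0}"
    "\<And>W S. W \<noteq> 0 \<Longrightarrow> norm W < 1 \<Longrightarrow>
       (\<lambda>n. \<Sum>r | \<bar>r\<bar> \<le> int (r0 n). c n r * (W ^ d) ^ n * (\<kappa> * W powi b) powi r) sums S \<Longrightarrow> g W = S"
proof -
  have fin: "finite {r. \<bar>r\<bar> \<le> int m}" for m
    by (rule finite_subset[of _ "{-int m..int m}"]) auto
  have card: "card {r. \<bar>r\<bar> \<le> int m} = 2 * m + 1" for m
  proof -
    have "{r. \<bar>r\<bar> \<le> int m} = {-int m..int m}" by auto
    thus ?thesis by simp
  qed
  \<comment> \<open>Chosen to give \<open>\<bar>b\<bar> * int (r0 n) \<le> int n\<close>; the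
    \<open>1\<close> covers \<open>b = 0\<close>.\<close>
  have "\<forall>\<^sub>F n in sequentially. real (r0 n) / real n < 1 / (1 + real_of_int \<bar>b\<bar>)"
    using r0 by (rule order_tendstoD) auto
  then obtain n0 where n0: "\<And>n. n \<ge> n0 \<Longrightarrow> real (r0 n) / real n < 1 / (1 + real_of_int \<bar>b\<bar>)"
    by (auto simp: eventually_sequentially)
  have nonneg: "\<bar>b\<bar> * int (r0 n) \<le> int n" if "n \<ge> Suc n0" for n
  proof -
    have B: "0 < 1 + real_of_int \<bar>b\<bar>" by (rule add_pos_nonneg) auto
    have n: "real n > 0" using that by simp
    have "real (r0 n) / real n < 1 / (1 + real_of_int \<bar>b\<bar>)" using that by (intro n0) auto
    hence "real (r0 n) < 1 / (1 + real_of_int \<bar>b\<bar>) * real n" by (simp only: pos_divide_less_eq[OF n])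
    hence "real (r0 n) * (1 + real_of_int \<bar>b\<bar>) < real n"
      using B by (simp add: pos_less_divide_eq)
    hence "real_of_int (\<bar>b\<bar> * int (r0 n)) \<le> real_of_int (int n)" by (simp add: algebra_simps)
    thus ?thesis by (simp only: of_int_le_iff)
  qed
  define N where "N = Suc n0"
  \<comment> \<open>\<open>T\<close> is the substituted term with integer powers; \<open>P\<close>
    has natural powers and so is holomorphic at \<open>0\<close> as well. They agree from
    \<open>N\<close> on.\<close>
  define T where "T = (\<lambda>n W. \<Sum>r | \<bar>r\<bar> \<le> int (r0 n). c n r * \<kappa> powi r * W powi (int (d * n) + b * r))"
  define P where "P = (\<lambda>n W. \<Sum>r | \<bar>r\<bar> \<le> int (r0 n). c n r * \<kappa> powi r * W ^ nat (int (d * n) + b * r))"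
  have br: "\<bar>b * r\<bar> \<le> \<bar>b\<bar> * int (r0 n)" if "\<bar>r\<bar> \<le> int (r0 n)" for n r
    using that by (simp add: abs_mult mult_left_mono)
  have dn: "int n \<le> int (d * n)" for n using \<open>d > 0\<close> by (simp del: of_nat_mult)
  have exponent: "0 \<le> int n - \<bar>b\<bar> * int (r0 n)" "int n - \<bar>b\<bar> * int (r0 n) \<le> int (d * n) + b * r"
    if "n \<ge> N" "\<bar>r\<bar> \<le> int (r0 n)" for n r
    using br[OF that(2)] nonneg[of n] dn[of n] that(1) unfolding N_def by linarith+
  have TP: "T n W = P n W" if "n \<ge> N" for n W
    unfolding T_def P_def
  proof (intro sum.cong refl)
    fix r assume "r \<in> {r. \<bar>r\<bar> \<le> int (r0 n)}"
    hence "int (d * n) + b * r \<ge> 0" using exponent[OF that, of r] by simp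
    thus "c n r * \<kappa> powi r * W powi (int (d * n) + b * r) = c n r * \<kappa> powi r * W ^ nat (int (d * n) + b * r)"
      by (simp add: power_int_def)
  qed
  define H where "H = (\<lambda>W. \<Sum>i. P (i + N) W)"
  have "H holomorphic_on ball 0 1"
  proof (rule holomorphic_uniform_sequence)
    show "(\<lambda>W. \<Sum>i<n. P (i + N) W) holomorphic_on ball 0 1" for n
      unfolding P_def by (intro holomorphic_intros)
    fix x :: complex assume x: "x \<in> ball 0 1"
    \<comment> \<open>Locally \<open>\<rho>\<close> is a radius halfway between
      \<open>norm x\<close> and \<open>1\<close>, not the function of that name.\<close>
    define \<rho> where "\<rho> = (1 + norm x) / 2"
    \<comment> \<open>Of the four factors \<open>s ^ n\<close> in \<open>\<rho> ^ n\<close>, the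
      coefficients use up two and \<open>G ^ r0 n\<close> one; the last yields a geometric
      majorant.\<close>
    define s where "s = root 4 \<rho>"
    have \<rho>: "0 < \<rho>" "\<rho> < 1" using x by (auto simp: \<rho>_def intro: add_pos_nonneg)
    have s: "0 < s" "s < 1" "s ^ 4 = \<rho>" using \<rho> by (auto simp: s_def)
    have ss: "s * s < s" using s by simp
    obtain K where K: "K > 0" "\<And>n r. \<bar>r\<bar> \<le> int (r0 n) \<Longrightarrow> norm (c n r) * (s * s) ^ n \<le> K"
    proof (rule laurent_coeff_subexponential_bound[OF r0 _ ss, of c])
      fix \<zeta> :: complex assume "\<zeta> \<noteq> 0"
      hence "summable (\<lambda>n. \<Sum>r | \<bar>r\<bar> \<le> int (r0 n). c n r * of_real s ^ n * \<zeta> powi r)"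
        using conv s by blast
      thus "Bseq (\<lambda>n. \<Sum>r | \<bar>r\<bar> \<le> int (r0 n). c n r * of_real s ^ n * \<zeta> powi r)"
        by (intro convergent_imp_Bseq convergentI[OF summable_LIMSEQ_zero])
    qed (use s in auto)
    \<comment> \<open>Covers exponents \<open>r\<close> of either sign.\<close>
    define \<kappa>0 where "\<kappa>0 = max (norm \<kappa>) (1 / norm \<kappa>)"
    have \<kappa>0: "\<kappa>0 \<ge> 1" using \<open>\<kappa> \<noteq> 0\<close>
      by (cases "norm \<kappa> \<ge> 1") (auto simp: \<kappa>0_def le_max_iff_disj pos_le_divide_eq)
    have \<kappa>_powi: "norm \<kappa> powi r \<le> \<kappa>0 ^ m" if "\<bar>r\<bar> \<le> int m" for r m
    proof -
      have "norm \<kappa> powi r \<le> \<kappa>0 ^ nat \<bar>r\<bar>"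
        by (auto simp: power_int_def \<kappa>0_def inverse_eq_divide intro!: power_mono)
      also have "\<dots> \<le> \<kappa>0 ^ m" using \<kappa>0 that by (intro power_increasing) auto
      finally show ?thesis .
    qed
    \<comment> \<open>Collects, per unit of \<open>r0 n\<close>, the number of summands, the powers
      of \<open>\<kappa>\<close>, and the loss in the exponent of \<open>W\<close> caused by
      \<open>b * r\<close>.\<close>
    define G where "G = 3 * (\<kappa>0 * (1 / \<rho>) ^ nat \<bar>b\<bar>)"
    have "1 * (1 * 1) \<le> G" unfolding G_def using \<kappa>0 \<rho> by (intro mult_mono one_le_power) auto
    hence G: "G \<ge> 1" by simp
    obtain K' where K': "K' > 0" "\<And>n. G ^ r0 n \<le> K' * (1 / s) ^ n"
      using power_sublinear_bound[OF r0 G, of "1 / s"] s by auto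
    have bound: "norm (P n W) \<le> K * K' * s ^ n" if W: "norm W \<le> \<rho>" and n: "n \<ge> N" for n W
    proof -
      have "norm (P n W) \<le> (\<Sum>r | \<bar>r\<bar> \<le> int (r0 n). (K / (s * s) ^ n) * \<kappa>0 ^ r0 n * (\<rho> ^ n * (1 / \<rho>) ^ (nat \<bar>b\<bar> * r0 n)))"
        unfolding P_def
      proof (rule sum_norm_le)
        fix r assume "r \<in> {r. \<bar>r\<bar> \<le> int (r0 n)}"
        hence r: "\<bar>r\<bar> \<le> int (r0 n)" by simp
        have ge: "0 \<le> int n - \<bar>b\<bar> * int (r0 n)" by (rule exponent(1)[OF n r])
        have "norm W ^ nat (int (d * n) + b * r) \<le> \<rho> ^ nat (int (d * n) + b * r)"
          using W by (intro power_mono) auto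
        also have "\<dots> \<le> \<rho> ^ nat (int n - \<bar>b\<bar> * int (r0 n))"
          using \<rho> by (intro power_decreasing nat_mono exponent(2)[OF n r]) auto
        also have "\<dots> = \<rho> powi (int n - \<bar>b\<bar> * int (r0 n))" using ge by (simp add: power_int_def)
        also have "\<dots> = \<rho> ^ n * (1 / \<rho>) ^ (nat \<bar>b\<bar> * r0 n)"
        proof -
          have "\<rho> powi (int n - \<bar>b\<bar> * int (r0 n)) = \<rho> powi int n / \<rho> powi int (nat \<bar>b\<bar> * r0 n)"
            using \<rho> by (subst power_int_diff[symmetric]) auto
          thus ?thesis unfolding power_int_of_nat by (simp add: power_divide)
        qed
        finally have 1: "norm W ^ nat (int (d * n) + b * r) \<le> \<rho> ^ n * (1 / \<rho>) ^ (nat \<bar>b\<bar> * r0 n)" .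
        have 2: "norm (c n r) \<le> K / (s * s) ^ n" using K(2)[OF r] s by (simp add: pos_le_divide_eq)
        show "norm (c n r * \<kappa> powi r * W ^ nat (int (d * n) + b * r)) \<le>
          (K / (s * s) ^ n) * \<kappa>0 ^ r0 n * (\<rho> ^ n * (1 / \<rho>) ^ (nat \<bar>b\<bar> * r0 n))"
          unfolding norm_mult norm_power norm_power_int
          using 1 2 \<kappa>_powi[OF r] K \<kappa>0 s \<rho> by (intro mult_mono) auto
      qed
      also have "\<dots> = (K / (s * s) ^ n) * \<rho> ^ n * (real (2 * r0 n + 1) * (\<kappa>0 * (1 / \<rho>) ^ nat \<bar>b\<bar>) ^ r0 n)"
        by (simp add: card power_mult power_mult_distrib)
      also have "\<dots> \<le> (K / (s * s) ^ n) * \<rho> ^ n * (3 ^ r0 n * (\<kappa>0 * (1 / \<rho>) ^ nat \<bar>b\<bar>) ^ r0 n)"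
        using K s \<rho> \<kappa>0 by (intro mult_left_mono mult_right_mono bernoulli_pow3) auto
      also have "\<dots> = (K / (s * s) ^ n) * \<rho> ^ n * G ^ r0 n" by (simp add: G_def power_mult_distrib)
      also have "\<dots> \<le> (K / (s * s) ^ n) * \<rho> ^ n * (K' * (1 / s) ^ n)"
        using K s \<rho> by (intro mult_left_mono K') auto
      also have "\<dots> = K * K' * (\<rho> / (s * s) * (1 / s)) ^ n" by (simp add: power_divide power_mult_distrib)
      also have "\<rho> / (s * s) * (1 / s) = s"
        using s(1) unfolding s(3)[symmetric] by (simp add: power4_eq_xxxx)
      finally show ?thesis .
    qed
    show "\<exists>d>0. cball x d \<subseteq> ball 0 1 \<and> uniform_limit (cball x d) (\<lambda>n W. \<Sum>i<n. P (i + N) W) H sequentially"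
    proof (intro exI conjI)
      have sub: "norm W \<le> \<rho>" if "W \<in> cball x ((1 - norm x) / 2)" for W
      proof -
        have "norm W \<le> norm x + norm (x - W)" by (metis norm_minus_commute norm_triangle_sub)
        also have "\<dots> \<le> norm x + (1 - norm x) / 2" using that by (simp add: dist_norm)
        also have "\<dots> = \<rho>" by (simp add: \<rho>_def field_simps)
        finally show ?thesis .
      qed
      show "0 < (1 - norm x) / 2" using x by simp
      show "cball x ((1 - norm x) / 2) \<subseteq> ball 0 1" using sub \<rho> by fastforce
      show "uniform_limit (cball x ((1 - norm x) / 2)) (\<lambda>n W. \<Sum>i<n. P (i + N) W) H sequentially"
        unfolding H_def
      proof (rule Weierstrass_m_test)
        show "norm (P (i + N) W) \<le> K * K' * s ^ (i + N)" if "W \<in> cball x ((1 - norm x) / 2)" for i W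
          by (rule bound[OF sub[OF that]]) simp
        have "summable (\<lambda>i. (K * K' * s ^ N) * s ^ i)"
          using s by (intro summable_mult summable_geometric) auto
        thus "summable (\<lambda>i. K * K' * s ^ (i + N))" by (simp add: power_add mult_ac)
      qed
    qed
  qed auto
  \<comment> \<open>Only the first \<open>N\<close> terms can contain negative powers of
    \<open>W\<close>, so at \<open>0\<close> there is at worst a pole.\<close>
  define g where "g = (\<lambda>W. (\<Sum>n<N. T n W) + H W)"
  show ?thesis
  proof (rule that[of g])
    have "H analytic_on {0}" using \<open>H holomorphic_on ball 0 1\<close>
      by (metis analytic_on_subset analytic_on_open centre_in_ball empty_subsetI insert_subset open_ball zero_less_one)
    thus "g meromorphic_on {0}" unfolding g_def T_def
      by (intro meromorphic_intros analytic_on_imp_meromorphic_on[of H])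
    have "H holomorphic_on ball 0 1 - {0}"
      using \<open>H holomorphic_on ball 0 1\<close> by (rule holomorphic_on_subset) auto
    thus "g holomorphic_on ball 0 1 - {0}" unfolding g_def T_def
      by (intro holomorphic_intros) auto
    fix W S assume W: "W \<noteq> 0" "norm W < 1"
      and sums: "(\<lambda>n. \<Sum>r | \<bar>r\<bar> \<le> int (r0 n). c n r * (W ^ d) ^ n * (\<kappa> * W powi b) powi r) sums S"
    have "(\<Sum>r | \<bar>r\<bar> \<le> int (r0 n). c n r * (W ^ d) ^ n * (\<kappa> * W powi b) powi r) = T n W" for n
      unfolding T_def
    proof (intro sum.cong refl)
      fix r
      have "(W ^ d) ^ n = W powi int (d * n)" by (simp add: power_mult power_int_of_nat del: of_nat_mult)
      moreover have "(\<kappa> * W powi b) powi r = \<kappa> powi r * W powi (b * r)"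
        by (simp add: power_int_mult_distrib power_int_mult)
      ultimately show "c n r * (W ^ d) ^ n * (\<kappa> * W powi b) powi r = c n r * \<kappa> powi r * W powi (int (d * n) + b * r)"
        using W by (simp add: power_int_add)
    qed
    hence T: "(\<lambda>n. T n W) sums S" using sums by simp
    hence "suminf (\<lambda>n. T n W) = S" "summable (\<lambda>n. T n W)" by (auto simp: sums_iff)
    hence "S = (\<Sum>i. T (i + N) W) + (\<Sum>n<N. T n W)"
      using suminf_split_initial_segment[of "\<lambda>n. T n W" N] by simp
    thus "g W = S" unfolding g_def H_def by (simp add: TP)
  qed
qed

section \<open>Principal congruence subgroups\<close>

lemma group_SL2Z: "group SL2Z"
proof (rule groupI)
  fix M assume M: "M \<in> carrier SL2Z"
  define A :: "int ^ 2 ^ 2" where "A = vector [vector [M $ 2 $ 2, - M $ 1 $ 2], vector [- M $ 2 $ 1, M $ 1 $ 1]]"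
  have "det M = 1" using M by (simp add: SL2Z_def)
  hence "A ** M = mat 1"
    by (simp add: vec_eq_iff forall_2 matrix_matrix_mult_def sum_2 A_def mat_def det_2 algebra_simps)
  moreover have "det A = 1" using \<open>det M = 1\<close> by (simp add: A_def det_2 algebra_simps)
  ultimately show "\<exists>N\<in>carrier SL2Z. N \<otimes>\<^bsub>SL2Z\<^esub> M = \<one>\<^bsub>SL2Z\<^esub>"
    by (intro bexI[of _ A]) (auto simp: SL2Z_def)
qed (auto simp: SL2Z_def det_mul matrix_mul_assoc)

text \<open>The intersection of \<open>\<Gamma>\<close> with the principal congruence subgroup of
  level \<open>m\<close>.\<close>

definition principal_congruence :: "int \<Rightarrow> (int ^ 2 ^ 2) set \<Rightarrow> (int ^ 2 ^ 2) set" where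
  "principal_congruence m \<Gamma> = {A \<in> \<Gamma>. \<forall>i j. m dvd (A - mat 1) $ i $ j}"

lemma dvd_matrix_mult:
  fixes A B :: "int ^ 2 ^ 2"
  assumes "\<forall>i j. m dvd A $ i $ j"
  shows "\<forall>i j. m dvd (A ** B) $ i $ j" "\<forall>i j. m dvd (B ** A) $ i $ j"
  using assms by (auto simp: matrix_matrix_mult_def intro!: dvd_sum)

lemma matrix_diff_distrib:
  fixes A B C :: "int ^ 2 ^ 2"
  shows "A ** (B - C) = A ** B - A ** C" "(B - C) ** A = B ** A - C ** A"
  by (simp_all add: matrix_matrix_mult_def vec_eq_iff sum_subtractf algebra_simps)

text \<open>Matrices congruent modulo \<open>m\<close> lie in the same right coset, because
  \<open>A - B\<close> times the inverse of \<open>B\<close> is again divisible by \<open>m\<close>;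
  and there are finitely many residues.\<close>

lemma finite_index_principal_congruence:
  assumes \<Gamma>: "subgroup \<Gamma> SL2Z" and "m > 0"
  shows "finite_index_subgroup (principal_congruence m \<Gamma>) (SL2Z\<lparr>carrier := \<Gamma>\<rparr>)"
proof -
  let ?G = "SL2Z\<lparr>carrier := \<Gamma>\<rparr>" and ?H = "principal_congruence m \<Gamma>"
  interpret G: group ?G by (rule subgroup.subgroup_is_group[OF \<Gamma> group_SL2Z])
  have G_simps [simp]: "A \<otimes>\<^bsub>SL2Z\<^esub> B = A ** B" "\<one>\<^bsub>SL2Z\<^esub> = mat 1" for A B
    by (simp_all add: SL2Z_def)
  have inv_r: "A ** inv\<^bsub>?G\<^esub> A = mat 1" if "A \<in> \<Gamma>" for A using G.r_inv[of A] that by simp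
  have inv_l: "inv\<^bsub>?G\<^esub> A ** A = mat 1" if "A \<in> \<Gamma>" for A using G.l_inv[of A] that by simp
  have inv_closed: "inv\<^bsub>?G\<^esub> A \<in> \<Gamma>" if "A \<in> \<Gamma>" for A using G.inv_closed[of A] that by simp
  have closed: "A ** B \<in> \<Gamma>" if "A \<in> \<Gamma>" "B \<in> \<Gamma>" for A B using G.m_closed[of A B] that by simp
  have one: "mat 1 \<in> \<Gamma>" using G.one_closed by simp
  have sub: "subgroup ?H ?G"
  proof (rule G.subgroupI)
    show "?H \<subseteq> carrier ?G" by (auto simp: principal_congruence_def)
    show "?H \<noteq> {}" using one by (auto simp: principal_congruence_def)
  next
    fix A assume A: "A \<in> ?H"
    have "inv\<^bsub>?G\<^esub> A - mat 1 = - (inv\<^bsub>?G\<^esub> A ** (A - mat 1))"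
      using inv_l[of A] A by (simp add: matrix_diff_distrib principal_congruence_def)
    moreover have "\<forall>i j. m dvd (inv\<^bsub>?G\<^esub> A ** (A - mat 1)) $ i $ j"
      by (rule dvd_matrix_mult) (use A in \<open>simp add: principal_congruence_def\<close>)
    ultimately show "inv\<^bsub>?G\<^esub> A \<in> ?H"
      using A inv_closed by (simp add: principal_congruence_def del: vector_minus_component)
  next
    fix A B assume A: "A \<in> ?H" and B: "B \<in> ?H"
    have eq: "A ** B - mat 1 = A ** (B - mat 1) + (A - mat 1)" by (simp add: matrix_diff_distrib)
    have "\<forall>i j. m dvd (A ** (B - mat 1)) $ i $ j"
      by (rule dvd_matrix_mult) (use B in \<open>simp add: principal_congruence_def\<close>)
    hence "\<forall>i j. m dvd (A ** B - mat 1) $ i $ j"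
      unfolding eq using A by (simp add: principal_congruence_def del: vector_minus_component)
    thus "A \<otimes>\<^bsub>?G\<^esub> B \<in> ?H"
      using A B closed by (simp add: principal_congruence_def del: vector_minus_component)
  qed
  \<comment> \<open>Reduction modulo \<open>m\<close>; each coset is recovered from the residues of
    any representative.\<close>
  define R where "R = (\<lambda>A :: int ^ 2 ^ 2. (A $ 1 $ 1 mod m, A $ 1 $ 2 mod m, A $ 2 $ 1 mod m, A $ 2 $ 2 mod m))"
  have coset_eq: "?H #>\<^bsub>?G\<^esub> A = ?H #>\<^bsub>?G\<^esub> B" if AB: "A \<in> \<Gamma>" "B \<in> \<Gamma>" "R A = R B" for A B
  proof -
    have "\<forall>i j. m dvd (A - B) $ i $ j"
      using AB(3) by (simp add: R_def forall_2 mod_eq_dvd_iff)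
    hence "\<forall>i j. m dvd ((A - B) ** inv\<^bsub>?G\<^esub> B) $ i $ j" by (rule dvd_matrix_mult)
    moreover have "(A - B) ** inv\<^bsub>?G\<^esub> B = A ** inv\<^bsub>?G\<^esub> B - mat 1"
      using inv_r[OF AB(2)] by (simp add: matrix_diff_distrib)
    ultimately have "A ** inv\<^bsub>?G\<^esub> B \<in> ?H"
      using AB inv_closed closed by (simp add: principal_congruence_def del: vector_minus_component)
    hence "?H #>\<^bsub>?G\<^esub> (A \<otimes>\<^bsub>?G\<^esub> inv\<^bsub>?G\<^esub> B) = ?H"
      using G.coset_join2[OF _ sub] closed[OF AB(1) inv_closed[OF AB(2)]] by simp
    thus ?thesis using AB sub by (intro G.coset_mult_inv1) (auto simp: principal_congruence_def)
  qed
  have "finite (R ` \<Gamma>)"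
  proof (rule finite_subset)
    show "R ` \<Gamma> \<subseteq> {0..<m} \<times> {0..<m} \<times> {0..<m} \<times> {0..<m}" using \<open>m > 0\<close> by (auto simp: R_def)
  qed auto
  moreover have "rcosets\<^bsub>?G\<^esub> ?H \<subseteq> (\<lambda>t. ?H #>\<^bsub>?G\<^esub> (SOME A. A \<in> \<Gamma> \<and> R A = t)) ` R ` \<Gamma>"
  proof
    fix C assume "C \<in> rcosets\<^bsub>?G\<^esub> ?H"
    then obtain A where A: "A \<in> \<Gamma>" "C = ?H #>\<^bsub>?G\<^esub> A" by (auto simp: RCOSETS_def)
    define B where "B = (SOME B. B \<in> \<Gamma> \<and> R B = R A)"
    have "B \<in> \<Gamma> \<and> R B = R A" unfolding B_def by (rule someI[of _ A]) (use A in auto)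
    hence "C = ?H #>\<^bsub>?G\<^esub> B" using coset_eq[of A B] A by simp
    thus "C \<in> (\<lambda>t. ?H #>\<^bsub>?G\<^esub> (SOME A. A \<in> \<Gamma> \<and> R A = t)) ` R ` \<Gamma>" unfolding B_def using A by blast
  qed
  ultimately have "finite (rcosets\<^bsub>?G\<^esub> ?H)" by (meson finite_imageI finite_subset)
  with sub show ?thesis by (simp add: finite_index_subgroup_def)
qed

section \<open>Torsion values\<close>

lemma slash_one: "slash k f (mat 1) \<tau> = f \<tau>"
  by (simp add: slash_def aut_factor_def moebius_act_def mat_def)

section \<open>Elementary properties of the exponential \<open>e\<close>\<close>

lemma e_surj_unit_interval:
  assumes "0 < q" "q < 1"
  obtains \<tau> where "Im \<tau> > 0" "e \<tau> = of_real q"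
proof
  have "2 * of_real pi * \<i> * (\<i> * of_real (- ln q / (2 * pi))) = complex_of_real (ln q)"
    by (simp add: field_simps)
  thus "e (\<i> * of_real (- ln q / (2 * pi))) = of_real q"
    unfolding e_def using assms by (simp add: exp_of_real)
  show "Im (\<i> * of_real (- ln q / (2 * pi))) > 0" using assms by (simp add: divide_neg_pos)
qed

lemma e_surj:
  assumes "\<zeta> \<noteq> 0"
  obtains z where "e z = \<zeta>"
proof
  show "e (Ln \<zeta> / (2 * of_real pi * \<i>)) = \<zeta>" using assms by (simp add: e_def)
qed

lemma e_add: "e (x + y) = e x * e y"
  by (simp add: e_def ring_distribs exp_add)

lemma e_of_int_mult: "e (of_int n * x) = e x powi n"
  by (simp add: e_def exp_power_int mult_ac)

lemma e_of_nat_mult: "e (of_nat n * x) = e x ^ n"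
  by (simp add: e_def mult_ac flip: exp_of_nat_mult)

lemma e_nonzero [simp]: "e x \<noteq> 0"
  by (simp add: e_def)

lemma norm_e_less_1: "Im x > 0 \<Longrightarrow> norm (e x) < 1"
  by (simp add: e_def)

text \<open>On a torsion section \<open>\<zeta>\<close> is a constant times a power of
  \<open>W = e (\<tau> / (2 * N^2))\<close>, so the expansion becomes a series in \<open>W\<close>.
  Holomorphy on the punctured disc is recorded too: for the identity matrix it yields holomorphy in
  \<open>\<tau>\<close>.\<close>

lemma torsion_value_at_cusp:
  fixes X :: "real ^ 2" and N :: nat
  assumes M: "det M = 1" and "N > 0"
    and X: "real N * X $ 1 \<in> \<int>" "real N * X $ 2 \<in> \<int>"
    and r0: "(\<lambda>n. real (r0 n) / real n) \<longlonglongrightarrow> 0"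
    and exp: "\<And>\<tau> z. Im \<tau> > 0 \<Longrightarrow>
       (\<lambda>n. \<Sum>r | \<bar>r\<bar> \<le> int (r0 n). c n r * e \<tau> ^ n * e z powi r) sums (\<rho> \<tau> z powi k * slash_mat k \<phi> M \<tau> z)"
  obtains g where "g meromorphic_on {0}" "g holomorphic_on ball 0 1 - {0}"
    "\<And>\<tau>. Im \<tau> > 0 \<Longrightarrow>
       slash k (\<lambda>\<tau>. slash_vec k \<phi> X \<tau> 0) M \<tau> = g (e (\<tau> / of_nat (2 * N\<^sup>2)))"
proof -
  define l where "l = X $ 1 * of_int (M $ 1 $ 1) + X $ 2 * of_int (M $ 2 $ 1)"
  define m where "m = X $ 1 * of_int (M $ 1 $ 2) + X $ 2 * of_int (M $ 2 $ 2)"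
  obtain u v :: int where uv: "real N * X $ 1 = of_int u" "real N * X $ 2 = of_int v"
    using X by (auto elim!: Ints_cases)
  define a where "a = u * M $ 1 $ 1 + v * M $ 2 $ 1"
  have "real N * l = (real N * X $ 1) * of_int (M $ 1 $ 1) + (real N * X $ 2) * of_int (M $ 2 $ 1)"
    by (simp add: l_def algebra_simps)
  hence "real N * l = of_int a" unfolding uv by (simp add: a_def)
  hence l: "l = of_int a / real N" using \<open>N > 0\<close> by (simp add: field_simps)
  have N: "complex_of_nat N \<noteq> 0" using \<open>N > 0\<close> by simp
  \<comment> \<open>With \<open>l = a / N\<close>, the exponent of \<open>W\<close> in
    \<open>e y\<close> is \<open>b\<close>, and the one in
    \<open>exp (pi * \<i> * (1 - l) * y)\<close> is \<open>p\<close>. The latter has denominator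
    \<open>2 * N^2\<close>, which dictates \<open>d\<close>.\<close>
  define d where "d = 2 * N\<^sup>2"
  define b where "b = 2 * int N * a"
  define p where "p = (int N - a) * a"
  define C where "C = exp (of_real pi * \<i> * of_real ((1 - l) * m))"
  \<comment> \<open>The value of \<open>\<psi>\<close> at \<open>y\<close>, the same for every
    \<open>\<tau>\<close>.\<close>
  define s where "s = (if l \<in> \<int> \<and> m \<in> \<int> \<and> \<not> (l / 2 \<in> \<int> \<and> m / 2 \<in> \<int>) then - 1 else 1 :: complex)"
  have "d > 0" using \<open>N > 0\<close> by (simp add: d_def)
  \<comment> \<open>Every such \<open>q\<close> and \<open>\<zeta>\<close> is of the form
    \<open>e \<tau>\<close> and \<open>e z\<close>, so the given expansion converges there.\<close>
  have conv: "summable (\<lambda>n. \<Sum>r | \<bar>r\<bar> \<le> int (r0 n). c n r * of_real q ^ n * \<zeta> powi r)"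
    if "0 < q" "q < 1" "\<zeta> \<noteq> 0" for q \<zeta>
  proof -
    obtain \<tau> where \<tau>: "Im \<tau> > 0" "e \<tau> = of_real q" using e_surj_unit_interval \<open>0 < q\<close> \<open>q < 1\<close> by blast
    obtain z where "e z = \<zeta>" using e_surj \<open>\<zeta> \<noteq> 0\<close> by blast
    thus ?thesis using exp[OF \<tau>(1), of z] unfolding \<tau>(2) by (auto simp: sums_iff)
  qed
  obtain g where g: "g meromorphic_on {0}" "g holomorphic_on ball 0 1 - {0}"
    "\<And>W S. W \<noteq> 0 \<Longrightarrow> norm W < 1 \<Longrightarrow>
       (\<lambda>n. \<Sum>r | \<bar>r\<bar> \<le> int (r0 n). c n r * (W ^ d) ^ n * (e (of_real m) * W powi b) powi r) sums S \<Longrightarrow> g W = S"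
    using q_zeta_series_meromorphic[OF r0 conv e_nonzero \<open>d > 0\<close>, of "of_real m" b] by blast
  define h where "h = (\<lambda>W. (s * (C * W powi p)) powi k * g W)"
  show ?thesis
  proof (rule that[of h])
    show "h meromorphic_on {0}" unfolding h_def by (intro meromorphic_intros g)
    have "C \<noteq> 0" "s \<noteq> 0" by (auto simp: C_def s_def)
    thus "h holomorphic_on ball 0 1 - {0}" unfolding h_def by (intro holomorphic_intros g) auto
    fix \<tau> :: complex assume \<tau>: "Im \<tau> > 0"
    define W where "W = e (\<tau> / of_nat d)"
    define y where "y = of_real l * \<tau> + of_real m"
    let ?L = "period_lattice \<tau> 1"
    have W: "W \<noteq> 0" "norm W < 1" using \<tau> \<open>d > 0\<close> by (auto simp: W_def intro!: norm_e_less_1)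
    have Wd: "e \<tau> = W ^ d" unfolding W_def e_of_nat_mult[symmetric] using \<open>d > 0\<close> by simp
    have "y = of_real m + of_int b * (\<tau> / of_nat d)"
      using N by (simp add: y_def l b_def d_def power2_eq_square field_simps)
    hence Wy: "e y = e (of_real m) * W powi b" by (simp only: e_add e_of_int_mult W_def)
    have "of_real pi * \<i> * (1 - of_real l) * y =
      of_real pi * \<i> * of_real ((1 - l) * m) + 2 * of_real pi * \<i> * (of_int p * (\<tau> / of_nat d))"
      using N by (simp add: y_def l p_def d_def power2_eq_square field_simps)
    hence Wp: "exp (of_real pi * \<i> * (1 - of_real l) * y) = C * W powi p"
      by (simp only: exp_add e_def[symmetric] e_of_int_mult C_def W_def)
    have gW: "g W = \<rho> \<tau> y powi k * slash_mat k \<phi> M \<tau> y"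
      using g(3)[OF W] exp[OF \<tau>, of y] unfolding Wy unfolding Wd by blast
    \<comment> \<open>The second summand is exactly the exponent of \<open>\<rho>\<close>, so
      \<open>\<eta>(1)\<close> disappears into the expansion and only a monomial in \<open>W\<close>
      is left over.\<close>
    have "weierstrass_eta y ?L * (y / 2) = of_real pi * \<i> * (1 - of_real l) * y
       + (weierstrass_eta 1 ?L * y\<^sup>2 / 2 - of_real pi * \<i> * y)"
      unfolding y_def weierstrass_eta_coords[OF \<tau>] by (simp add: field_simps power2_eq_square)
    hence "exp (weierstrass_eta y ?L * (y / 2)) = C * W powi p * \<rho> \<tau> y"
      unfolding \<rho>_def Wp[symmetric] by (simp only: exp_add)
    moreover have "\<psi> y ?L = s" unfolding y_def s_def by (rule \<psi>_coords[OF \<tau>])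
    ultimately have "slash k (\<lambda>\<tau>. slash_vec k \<phi> X \<tau> 0) M \<tau> = (s * (C * W powi p * \<rho> \<tau> y)) powi k * slash_mat k \<phi> M \<tau> y"
      using slash_slash_vec[OF M \<tau>, of k \<phi> X] unfolding l_def[symmetric] m_def[symmetric] y_def[symmetric] by simp
    also have "\<dots> = h W" unfolding h_def gW by (simp add: power_int_mult_distrib)
    finally show "slash k (\<lambda>\<tau>. slash_vec k \<phi> X \<tau> 0) M \<tau> = h (e (\<tau> / of_nat (2 * N\<^sup>2)))"
      unfolding W_def d_def .
  qed
qed

text \<open>Modulo \<open>2 * N^2\<close> the matrix is the identity, so \<open>X\<close> times
  \<open>M\<close> is \<open>X + Y\<close> with \<open>Y\<close> in \<open>2N\<close> times the
  integer lattice. Invariance of \<open>\<phi>\<close> under \<open>M\<close> and under the even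
  shift \<open>Y\<close> then applies.\<close>

lemma torsion_value_invariant:
  fixes X :: "real ^ 2" and N :: nat
  assumes M: "M \<in> principal_congruence (2 * int N ^ 2) \<Gamma>" "det M = 1" and "N > 0"
    and X: "real N * X $ 1 \<in> \<int>" "real N * X $ 2 \<in> \<int>"
    and \<phi>: "\<phi> \<in> J k \<Gamma>" and \<tau>: "Im \<tau> > 0"
  shows "slash k (\<lambda>\<tau>. slash_vec k \<phi> X \<tau> 0) M \<tau> = slash_vec k \<phi> X \<tau> 0"
proof -
  obtain u v :: int where uv: "real N * X $ 1 = of_int u" "real N * X $ 2 = of_int v"
    using X by (auto elim!: Ints_cases)
  have "\<forall>i j. \<exists>t. (M - mat 1) $ i $ j = 2 * int N ^ 2 * t"
    using M by (auto simp: principal_congruence_def dvd_def)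
  then obtain t where t: "\<And>i j. (M - mat 1) $ i $ j = 2 * int N ^ 2 * t i j" by metis
  have M_eq: "M $ 1 $ 1 = 1 + 2 * int N ^ 2 * t 1 1" "M $ 1 $ 2 = 2 * int N ^ 2 * t 1 2"
    "M $ 2 $ 1 = 2 * int N ^ 2 * t 2 1" "M $ 2 $ 2 = 1 + 2 * int N ^ 2 * t 2 2"
    using t[of 1 1] t[of 1 2] t[of 2 1] t[of 2 2] by (simp_all add: mat_def)
  \<comment> \<open>\<open>M\<close> is the identity plus \<open>2 * N^2\<close> times the matrix
    \<open>t\<close>, and \<open>(u, v)\<close> is \<open>N\<close> times \<open>X\<close>; hence
    \<open>Y\<close> is \<open>2N\<close> times \<open>(u, v)\<close> times
    \<open>t\<close>.\<close>
  define l m where "l = u * t 1 1 + v * t 2 1" and "m = u * t 1 2 + v * t 2 2"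
  define Y :: "real ^ 2" where "Y = vector [of_int (2 * int N * l), of_int (2 * int N * m)]"
  have "X $ 1 * of_int (M $ 1 $ 1) + X $ 2 * of_int (M $ 2 $ 1) =
     X $ 1 + 2 * real N * ((real N * X $ 1) * of_int (t 1 1) + (real N * X $ 2) * of_int (t 2 1))"
    by (simp add: M_eq algebra_simps power2_eq_square)
  also have "\<dots> = (X + Y) $ 1" unfolding uv by (simp add: Y_def l_def)
  finally have 1: "X $ 1 * of_int (M $ 1 $ 1) + X $ 2 * of_int (M $ 2 $ 1) = (X + Y) $ 1" .
  have "X $ 1 * of_int (M $ 1 $ 2) + X $ 2 * of_int (M $ 2 $ 2) =
     X $ 2 + 2 * real N * ((real N * X $ 1) * of_int (t 1 2) + (real N * X $ 2) * of_int (t 2 2))"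
    by (simp add: M_eq algebra_simps power2_eq_square)
  also have "\<dots> = (X + Y) $ 2" unfolding uv by (simp add: Y_def m_def)
  finally have 2: "X $ 1 * of_int (M $ 1 $ 2) + X $ 2 * of_int (M $ 2 $ 2) = (X + Y) $ 2" .
  have \<tau>': "\<tau> \<in> upper_half_plane" using \<tau> by (simp add: upper_half_plane_def)
  have "M \<in> \<Gamma>" using M by (simp add: principal_congruence_def)
  hence inv: "slash_mat k \<phi> M \<tau> z = \<phi> \<tau> z" for z using \<phi> \<tau>' by (simp add: J_def)
  have "slash k (\<lambda>\<tau>. slash_vec k \<phi> X \<tau> 0) M \<tau> = slash_vec k \<phi> (X + Y) \<tau> 0"
    unfolding slash_slash_vec[OF M(2) \<tau>] inv 1 2 unfolding slash_vec_def Let_def by simp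
  also have "\<dots> = slash_vec k \<phi> X \<tau> 0"
  proof (rule slash_vec_even_shift[OF \<tau>])
    have Y: "Y $ 1 = of_int (2 * int N * l)" "Y $ 2 = of_int (2 * int N * m)" by (simp_all add: Y_def)
    have "Y $ 1 / 2 = of_int (int N * l)" "Y $ 2 / 2 = of_int (int N * m)" by (simp_all add: Y)
    thus "Y $ 1 / 2 \<in> \<int>" "Y $ 2 / 2 \<in> \<int>" by (metis Ints_of_int)+
    \<comment> \<open>The factor \<open>N\<close> in \<open>Y\<close> clears the denominators of
      \<open>X\<close>, and the factor \<open>2\<close> makes the determinant even.\<close>
    have "(X $ 1 * Y $ 2 - Y $ 1 * X $ 2) / 2 = (real N * X $ 1) * of_int m - (real N * X $ 2) * of_int l"
      by (simp add: Y field_simps)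
    also have "\<dots> = of_int (u * m - v * l)" unfolding uv by simp
    finally show "(X $ 1 * Y $ 2 - Y $ 1 * X $ 2) / 2 \<in> \<int>" by (metis Ints_of_int)
    have "\<forall>i. Y $ i \<in> \<int>" unfolding forall_2 Y by (intro conjI Ints_of_int)
    thus "slash_vec k \<phi> Y \<tau> z = \<phi> \<tau> z" for z using \<phi> \<tau>' unfolding J_def by blast
  qed
  finally show ?thesis .
qed

lemma rat_common_denominator:
  fixes X :: "real ^ 2"
  assumes "\<forall>i. X $ i \<in> \<rat>"
  obtains N :: nat where "N > 0" "real N * X $ 1 \<in> \<int>" "real N * X $ 2 \<in> \<int>"
proof -
  have ex: "\<exists>n>0. real n * x \<in> \<int>" if x: "x \<in> \<rat>" for x :: real
  proof -
    obtain a b :: int where "b > 0" "x = of_int a / of_int b"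
      using x by (metis Rats_cases')
    hence "real (nat b) * x = of_int a" by simp
    thus ?thesis using \<open>b > 0\<close> by (intro exI[of _ "nat b"]) simp
  qed
  obtain n1 n2 where n: "n1 > 0" "real n1 * X $ 1 \<in> \<int>" "n2 > 0" "real n2 * X $ 2 \<in> \<int>"
    using ex[of "X $ 1"] ex[of "X $ 2"] assms by blast
  show ?thesis
  proof (rule that[of "n1 * n2"])
    show "n1 * n2 > 0" using n by simp
    have "real (n1 * n2) * X $ 1 = of_nat n2 * (real n1 * X $ 1)" by simp
    thus "real (n1 * n2) * X $ 1 \<in> \<int>" using n by (metis Ints_mult Ints_of_nat)
    have "real (n1 * n2) * X $ 2 = of_nat n1 * (real n2 * X $ 2)" by simp
    thus "real (n1 * n2) * X $ 2 \<in> \<int>" using n by (metis Ints_mult Ints_of_nat)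
  qed
qed

theorem theorem3p2:
  fixes \<Gamma> :: "(int ^ 2 ^ 2) set" and X :: "real ^ 2"
  assumes "finite_index_subgroup \<Gamma> SL2Z"
    and "\<forall>i. X $ i \<in> \<rat>"
  shows "\<exists>\<Gamma>'. finite_index_subgroup \<Gamma>' (SL2Z\<lparr>carrier := \<Gamma>\<rparr>) \<and>
    (\<forall>k :: int. \<forall>\<phi> \<in> J k \<Gamma>.
       nearly_holomorphic_modular_form k \<Gamma>' (\<lambda>\<tau>. slash_vec k \<phi> X \<tau> 0))"
proof -
  have \<Gamma>: "subgroup \<Gamma> SL2Z" using assms(1) by (simp add: finite_index_subgroup_def)
  obtain N :: nat where N: "N > 0" "real N * X $ 1 \<in> \<int>" "real N * X $ 2 \<in> \<int>"
    using rat_common_denominator[OF assms(2)] by blast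
  \<comment> \<open>Fixed before \<open>k\<close> and \<open>\<phi>\<close>: the level involves only
    a common denominator of \<open>X\<close>.\<close>
  let ?\<Gamma>' = "principal_congruence (2 * int N ^ 2) \<Gamma>"
  have "nearly_holomorphic_modular_form k ?\<Gamma>' (\<lambda>\<tau>. slash_vec k \<phi> X \<tau> 0)" if \<phi>: "\<phi> \<in> J k \<Gamma>" for k \<phi>
  proof -
    let ?f = "\<lambda>\<tau>. slash_vec k \<phi> X \<tau> 0"
    have cusp: "\<exists>g. g meromorphic_on {0} \<and> g holomorphic_on ball 0 1 - {0} \<and>
       (\<forall>\<tau>. Im \<tau> > 0 \<longrightarrow> slash k ?f M \<tau> = g (e (\<tau> / of_nat (2 * N\<^sup>2))))" if M: "det M = 1" for M
    proof -
      have "M \<in> carrier SL2Z" using M by (simp add: SL2Z_def)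
      then obtain r0 :: "nat \<Rightarrow> nat" and c :: "nat \<Rightarrow> int \<Rightarrow> complex" where
        r0: "(\<lambda>n. real (r0 n) / real n) \<longlonglongrightarrow> 0" and
        sums: "\<And>\<tau> z. \<tau> \<in> upper_half_plane \<Longrightarrow>
           (\<lambda>n. \<Sum>r | \<bar>r\<bar> \<le> int (r0 n). c n r * e \<tau> ^ n * e z powi r)
             sums (\<rho> \<tau> z powi k * slash_mat k \<phi> M \<tau> z)"
        using \<phi> unfolding J_def by blast
      have "(\<lambda>n. \<Sum>r | \<bar>r\<bar> \<le> int (r0 n). c n r * e \<tau> ^ n * e z powi r)
         sums (\<rho> \<tau> z powi k * slash_mat k \<phi> M \<tau> z)" if "Im \<tau> > 0" for \<tau> z
        using that by (intro sums) (simp add: upper_half_plane_def)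
      from torsion_value_at_cusp[OF M N r0 this] show ?thesis by blast
    qed
    \<comment> \<open>The expansion at the identity matrix exhibits the function as a holomorphic
      function on the punctured disc composed with an exponential.\<close>
    have hol: "?f holomorphic_on upper_half_plane"
    proof -
      obtain g where g: "g holomorphic_on ball 0 1 - {0}"
        "\<And>\<tau>. Im \<tau> > 0 \<Longrightarrow> slash k ?f (mat 1) \<tau> = g (e (\<tau> / of_nat (2 * N\<^sup>2)))"
        using cusp[of "mat 1"] by auto
      have "(g \<circ> (\<lambda>\<tau>. e (\<tau> / of_nat (2 * N\<^sup>2)))) holomorphic_on upper_half_plane"
      proof (rule holomorphic_on_compose_gen[OF _ g(1)])
        show "(\<lambda>\<tau>. e (\<tau> / of_nat (2 * N\<^sup>2))) holomorphic_on upper_half_plane"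
          unfolding e_def using N(1) by (intro holomorphic_intros) auto
        show "(\<lambda>\<tau>. e (\<tau> / of_nat (2 * N\<^sup>2))) ` upper_half_plane \<subseteq> ball 0 1 - {0}"
          using N(1) by (auto simp: upper_half_plane_def intro!: norm_e_less_1)
      qed
      thus ?thesis
        by (rule holomorphic_transform) (use g(2) in \<open>auto simp: upper_half_plane_def slash_one\<close>)
    qed
    have inv: "slash k ?f M \<tau> = ?f \<tau>" if "M \<in> ?\<Gamma>'" "\<tau> \<in> upper_half_plane" for M \<tau>
    proof (rule torsion_value_invariant[OF that(1) _ N \<phi>])
      have "M \<in> carrier SL2Z"
        using that(1) subgroup.subset[OF \<Gamma>] by (auto simp: principal_congruence_def)
      thus "det M = 1" by (simp add: SL2Z_def)
    qed (use that in \<open>simp add: upper_half_plane_def\<close>)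
    have "\<exists>n>0. \<exists>g. g meromorphic_on {0} \<and> (\<forall>\<tau>\<in>upper_half_plane. slash k ?f M \<tau> = g (e (\<tau> / of_nat n)))"
      if "M \<in> carrier SL2Z" for M
    proof (intro exI[of _ "2 * N\<^sup>2"] conjI)
      show "2 * N\<^sup>2 > 0" using N by simp
      show "\<exists>g. g meromorphic_on {0} \<and> (\<forall>\<tau>\<in>upper_half_plane. slash k ?f M \<tau> = g (e (\<tau> / of_nat (2 * N\<^sup>2))))"
        using cusp[of M] that unfolding SL2Z_def upper_half_plane_def by auto
    qed
    with hol inv show ?thesis unfolding nearly_holomorphic_modular_form_def by blast
  qed
  moreover have "finite_index_subgroup ?\<Gamma>' (SL2Z\<lparr>carrier := \<Gamma>\<rparr>)"
    using N(1) by (intro finite_index_principal_congruence[OF \<Gamma>]) simp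
  ultimately show ?thesis by blast
qed

end
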